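(* Let $\mathcal{F}_{\rm c}$ be the class of all finite groups equipped with a commutator-contractive invariant length function. Higman's group $$H = \langle a_0,a_1,a_2,a_3 \mid a_i = [a_{i+1},a_i] \text{ for all } i \in \mathbb{Z}/4\mathbb{Z} \rangle$$ does not have the $\mathcal{F}_{\rm c}$-approximation property.
   Context: Commutators are $[g,h] = ghg^{-1}h^{-1}$. An invariant length function on a group $G$ is a map $\ell \colon G \to [0,1]$ such that $\ell(g)=0$ if and only if $g=e$, and $\ell(gh) \leq \ell(g)+\ell(h)$, $\ell(g^{-1})=\ell(g)$, $\ell(hg)=\ell(gh)$ for all $g,h \in G$. It induces the metric $d(g,h) := \ell(gh^{-1})$ on $G$. It is called commutator-contractive if $\ell([g,h]) \leq 4\,\ell(g)\,\ell(h)$ for all $g,h \in G$. Let $\mathcal{C}$ be a class of groups with an invariant length function. A group $G$ has the $\mathcal{C}$-approximation property if for every $g \in G \setminus \{e\}$ there exists $\delta_g>0$ such that for all finite subsets $F \subset G$ and all $\varepsilon>0$ there exist a group $C \in \mathcal{C}$ and a map (not necessarily a homomorphism) $\varphi \colon G \to C$ such that (1) $\varphi(e)=e$; (2) $d(\varphi(gh),\varphi(g)\varphi(h)) < \varepsilon$ for all $g,h \in F$; (3) $\ell(\varphi(g)) \geq \delta_g$ for all $g \in F \setminus \{e\}$. *)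

theory Defs
  imports Complex_Main "HOL-Algebra.Group" "HOL-Library.Numeral_Type"
begin

section \<open>Groups with an invariant length function\<close>

definition commutator :: "('a, 'm) monoid_scheme \<Rightarrow> 'a \<Rightarrow> 'a \<Rightarrow> 'a" where
  "commutator G g h = g \<otimes>\<^bsub>G\<^esub> h \<otimes>\<^bsub>G\<^esub> inv\<^bsub>G\<^esub> g \<otimes>\<^bsub>G\<^esub> inv\<^bsub>G\<^esub> h"

locale invariant_length = group G for G (structure) +
  fixes len :: "'a \<Rightarrow> real"
  assumes len_range: "g \<in> carrier G \<Longrightarrow> len g \<in> {0..1}"
    and len_eq_0_iff: "g \<in> carrier G \<Longrightarrow> len g = 0 \<longleftrightarrow> g = \<one>"
    and len_mult_le: "g \<in> carrier G \<Longrightarrow> h \<in> carrier G \<Longrightarrow> len (g \<otimes> h) \<le> len g + len h"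
    and len_inv: "g \<in> carrier G \<Longrightarrow> len (inv g) = len g"
    and len_mult_commute: "g \<in> carrier G \<Longrightarrow> h \<in> carrier G \<Longrightarrow> len (h \<otimes> g) = len (g \<otimes> h)"

definition len_dist :: "('a, 'm) monoid_scheme \<Rightarrow> ('a \<Rightarrow> real) \<Rightarrow> 'a \<Rightarrow> 'a \<Rightarrow> real" where
  "len_dist G len g h = len (g \<otimes>\<^bsub>G\<^esub> inv\<^bsub>G\<^esub> h)"

definition commutator_contractive :: "('a, 'm) monoid_scheme \<Rightarrow> ('a \<Rightarrow> real) \<Rightarrow> bool" where
  "commutator_contractive G len \<longleftrightarrow>
    (\<forall>g\<in>carrier G. \<forall>h\<in>carrier G. len (commutator G g h) \<le> 4 * len g * len h)"

text \<open>
  A class of groups with length function is a set of pairs. The family \<open>\<delta>\<close> is chosen before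
  \<open>F\<close> and \<open>\<epsilon>\<close>, and its value at an element depends on that element only.
\<close>

definition approximation_property ::
  "('c monoid \<times> ('c \<Rightarrow> real)) set \<Rightarrow> ('g, 'm) monoid_scheme \<Rightarrow> bool" where
  "approximation_property \<C> G \<longleftrightarrow>
    (\<exists>\<delta> :: 'g \<Rightarrow> real. (\<forall>g \<in> carrier G - {\<one>\<^bsub>G\<^esub>}. \<delta> g > 0) \<and>
      (\<forall>F \<epsilon>. finite F \<and> F \<subseteq> carrier G \<and> \<epsilon> > 0 \<longrightarrow>
        (\<exists>(C, len) \<in> \<C>. \<exists>\<phi> \<in> carrier G \<rightarrow> carrier C.
          \<phi> \<one>\<^bsub>G\<^esub> = \<one>\<^bsub>C\<^esub> \<and>
          (\<forall>g\<in>F. \<forall>h\<in>F. len_dist C len (\<phi> (g \<otimes>\<^bsub>G\<^esub> h)) (\<phi> g \<otimes>\<^bsub>C\<^esub> \<phi> h) < \<epsilon>) \<and>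
          (\<forall>g \<in> F - {\<one>\<^bsub>G\<^esub>}. len (\<phi> g) \<ge> \<delta> g))))"

text \<open>
  The members of this class have their elements in the type \<open>'c\<close>. At \<open>'c = nat\<close> every finite
  group with a commutator-contractive length function occurs up to length-preserving isomorphism,
  so that instance is the class of all such groups; a statement with \<open>'c\<close> left arbitrary
  contains it. Conversely, the lemma below shows that no other type \<open>'c\<close> allows more
  approximations than \<open>nat\<close> does.
\<close>

definition finite_cc_groups :: "('c monoid \<times> ('c \<Rightarrow> real)) set" where
  "finite_cc_groups =
    {(C, len). finite (carrier C) \<and> invariant_length C len \<and> commutator_contractive C len}"

lemma finite_cc_groups_nat:
  fixes C :: "'c monoid"
  assumes "(C, len) \<in> finite_cc_groups"
  obtains D :: "nat monoid" and len' f where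
    "(D, len') \<in> finite_cc_groups" "f \<in> iso C D" "\<And>x. x \<in> carrier C \<Longrightarrow> len' (f x) = len x"
proof -
  have fin: "finite (carrier C)" and il: "invariant_length C len"
    and cc: "commutator_contractive C len"
    using assms by (auto simp: finite_cc_groups_def)
  interpret C: invariant_length C len by fact
  from finite_imp_inj_to_nat_seg[OF fin] obtain f :: "'c \<Rightarrow> nat" where f: "inj_on f (carrier C)"
    by blast
  define g where "g = inv_into (carrier C) f"
  have gf [simp]: "g (f x) = x" if "x \<in> carrier C" for x
    using f that by (simp add: g_def)
  define D where "D = \<lparr>carrier = f ` carrier C, mult = (\<lambda>x y. f (g x \<otimes>\<^bsub>C\<^esub> g y)), one = f \<one>\<^bsub>C\<^esub>\<rparr>"
  define len' where "len' = len \<circ> g"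
  have iso: "f \<in> iso C D"
    using f by (auto simp: iso_def hom_def D_def bij_betw_def)
  have carrier_D: "carrier D = f ` carrier C" and one_D: "\<one>\<^bsub>D\<^esub> = f \<one>\<^bsub>C\<^esub>"
    by (simp_all add: D_def)
  have "group D"
    using C.iso_imp_img_group[OF iso] by (simp add: D_def)
  interpret D: group D by fact
  interpret h: group_hom C D f
    using iso by unfold_locales (auto simp: iso_def)
  have mult_D: "f x \<otimes>\<^bsub>D\<^esub> f y = f (x \<otimes>\<^bsub>C\<^esub> y)" and inv_D: "inv\<^bsub>D\<^esub> f x = f (inv\<^bsub>C\<^esub> x)"
    if "x \<in> carrier C" "y \<in> carrier C" for x y
    using that by simp_all
  have len': "len' (f x) = len x" if "x \<in> carrier C" for x
    using that by (simp add: len'_def)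
  have "invariant_length D len'"
  proof
    fix a assume "a \<in> carrier D"
    then obtain x where x: "x \<in> carrier C" "a = f x" by (auto simp: carrier_D)
    show "len' a \<in> {0..1}" using x C.len_range by (simp add: len')
    show "len' a = 0 \<longleftrightarrow> a = \<one>\<^bsub>D\<^esub>"
      using x C.len_eq_0_iff inj_on_eq_iff[OF f] by (simp add: len' one_D del: h.hom_one)
    show "len' (inv\<^bsub>D\<^esub> a) = len' a"
      using x C.len_inv inv_D by (simp add: len' del: h.hom_inv)
    fix b assume "b \<in> carrier D"
    then obtain y where y: "y \<in> carrier C" "b = f y" by (auto simp: carrier_D)
    show "len' (a \<otimes>\<^bsub>D\<^esub> b) \<le> len' a + len' b"
      using x y C.len_mult_le by (simp add: len' mult_D del: h.hom_mult)
    show "len' (b \<otimes>\<^bsub>D\<^esub> a) = len' (a \<otimes>\<^bsub>D\<^esub> b)"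
      using x y C.len_mult_commute by (simp add: len' mult_D del: h.hom_mult)
  qed
  moreover have "commutator_contractive D len'"
    unfolding commutator_contractive_def
  proof (intro ballI)
    fix a b assume "a \<in> carrier D" "b \<in> carrier D"
    then obtain x y where xy: "x \<in> carrier C" "a = f x" "y \<in> carrier C" "b = f y"
      by (auto simp: carrier_D)
    then have "commutator D a b = f (commutator C x y)" "commutator C x y \<in> carrier C"
      by (simp_all add: commutator_def)
    then show "len' (commutator D a b) \<le> 4 * len' a * len' b"
      using xy cc by (simp add: len' commutator_contractive_def)
  qed
  moreover have "finite (carrier D)"
    using fin by (simp add: carrier_D)
  ultimately have "(D, len') \<in> finite_cc_groups"
    by (simp add: finite_cc_groups_def)
  then show thesis using iso len' by (rule that)
qed

lemma approximation_property_nat: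
  fixes G (structure)
  assumes G: "group G"
    and "approximation_property (finite_cc_groups :: ('c monoid \<times> ('c \<Rightarrow> real)) set) G"
  shows "approximation_property (finite_cc_groups :: (nat monoid \<times> (nat \<Rightarrow> real)) set) G"
proof -
  interpret group G by fact
  obtain \<delta> where pos: "\<And>g. g \<in> carrier G - {\<one>} \<Longrightarrow> \<delta> g > 0"
    and ex: "\<And>F \<epsilon>. finite F \<Longrightarrow> F \<subseteq> carrier G \<Longrightarrow> \<epsilon> > 0 \<Longrightarrow>
        \<exists>(C :: 'c monoid, len) \<in> finite_cc_groups. \<exists>\<phi> \<in> carrier G \<rightarrow> carrier C.
          \<phi> \<one> = \<one>\<^bsub>C\<^esub> \<and>
          (\<forall>g\<in>F. \<forall>h\<in>F. len_dist C len (\<phi> (g \<otimes> h)) (\<phi> g \<otimes>\<^bsub>C\<^esub> \<phi> h) < \<epsilon>) \<and>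
          (\<forall>g \<in> F - {\<one>}. len (\<phi> g) \<ge> \<delta> g)"
    using assms(2) unfolding approximation_property_def by (elim exE conjE) blast
  show ?thesis
    unfolding approximation_property_def
  proof (intro exI[of _ \<delta>] conjI ballI allI impI)
    fix F and \<epsilon> :: real assume F: "finite F \<and> F \<subseteq> carrier G \<and> \<epsilon> > 0"
    obtain C :: "'c monoid" and len \<phi> where C: "(C, len) \<in> finite_cc_groups"
      and \<phi>: "\<phi> \<in> carrier G \<rightarrow> carrier C" "\<phi> \<one> = \<one>\<^bsub>C\<^esub>"
      and d: "\<And>g h. g \<in> F \<Longrightarrow> h \<in> F \<Longrightarrow> len_dist C len (\<phi> (g \<otimes> h)) (\<phi> g \<otimes>\<^bsub>C\<^esub> \<phi> h) < \<epsilon>"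
      and l: "\<And>g. g \<in> F - {\<one>} \<Longrightarrow> len (\<phi> g) \<ge> \<delta> g"
      using ex[of F \<epsilon>] F by blast
    from finite_cc_groups_nat[OF C] obtain D :: "nat monoid" and len' f where
      D: "(D, len') \<in> finite_cc_groups" and f: "f \<in> iso C D"
      and len': "\<And>x. x \<in> carrier C \<Longrightarrow> len' (f x) = len x"
      by blast
    interpret C: invariant_length C len using C by (simp add: finite_cc_groups_def)
    interpret D: invariant_length D len' using D by (simp add: finite_cc_groups_def)
    interpret h: group_hom C D f using f by unfold_locales (auto simp: iso_def)
    have \<phi>_closed [simp]: "\<phi> g \<in> carrier C" if "g \<in> carrier G" for g using that \<phi> by auto
    have "len_dist D len' (f (\<phi> (g \<otimes> h))) (f (\<phi> g) \<otimes>\<^bsub>D\<^esub> f (\<phi> h)) < \<epsilon>"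
      if "g \<in> F" "h \<in> F" for g h
    proof -
      have gh: "g \<in> carrier G" "h \<in> carrier G" using that F by auto
      then have "len_dist D len' (f (\<phi> (g \<otimes> h))) (f (\<phi> g) \<otimes>\<^bsub>D\<^esub> f (\<phi> h))
          = len' (f (\<phi> (g \<otimes> h) \<otimes>\<^bsub>C\<^esub> inv\<^bsub>C\<^esub> (\<phi> g \<otimes>\<^bsub>C\<^esub> \<phi> h)))"
        unfolding len_dist_def by (simp del: D.inv_mult_group C.inv_mult_group)
      also have "\<dots> = len_dist C len (\<phi> (g \<otimes> h)) (\<phi> g \<otimes>\<^bsub>C\<^esub> \<phi> h)"
        using gh by (simp add: len' len_dist_def del: h.hom_mult h.hom_inv)
      finally show ?thesis using d[OF that] by simp
    qed
    moreover have "\<delta> g \<le> len' (f (\<phi> g))" if "g \<in> F - {\<one>}" for g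
    proof -
      have "g \<in> carrier G" using that F by blast
      then show ?thesis using l[OF that] by (simp add: len')
    qed
    moreover have "f \<circ> \<phi> \<in> carrier G \<rightarrow> carrier D" by auto
    moreover have "(f \<circ> \<phi>) \<one> = \<one>\<^bsub>D\<^esub>" by (simp add: \<phi>)
    ultimately show "\<exists>(C :: nat monoid, len) \<in> finite_cc_groups. \<exists>\<phi> \<in> carrier G \<rightarrow> carrier C.
          \<phi> \<one> = \<one>\<^bsub>C\<^esub> \<and>
          (\<forall>g\<in>F. \<forall>h\<in>F. len_dist C len (\<phi> (g \<otimes> h)) (\<phi> g \<otimes>\<^bsub>C\<^esub> \<phi> h) < \<epsilon>) \<and>
          (\<forall>g \<in> F - {\<one>}. len (\<phi> g) \<ge> \<delta> g)"
      by (intro bexI[OF _ D] case_prodI bexI[of _ "f \<circ> \<phi>"] conjI ballI) simp_all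
  qed (use pos in auto)
qed

section \<open>Groups given by generators and relations\<close>

text \<open>
  A letter \<open>(x, True)\<close> stands for the generator \<open>x\<close> and \<open>(x, False)\<close> for its inverse. The
  generating set is the whole type \<open>'x\<close>, and a pair \<open>(u, v)\<close> of words is the relation \<open>u = v\<close>.
  The presented group consists of all words modulo the least congruence for concatenation that
  contains the free cancellations and the given relations.
\<close>

type_synonym 'x word = "('x \<times> bool) list"

inductive word_eq :: "('x word \<times> 'x word) set \<Rightarrow> 'x word \<Rightarrow> 'x word \<Rightarrow> bool"
  for R :: "('x word \<times> 'x word) set" where
  refl: "word_eq R u u"
| sym: "word_eq R u v \<Longrightarrow> word_eq R v u"
| trans: "word_eq R u v \<Longrightarrow> word_eq R v w \<Longrightarrow> word_eq R u w"
| append: "word_eq R u u' \<Longrightarrow> word_eq R v v' \<Longrightarrow> word_eq R (u @ v) (u' @ v')"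
| cancel: "word_eq R [(x, b), (x, \<not> b)] []"
| rel: "(u, v) \<in> R \<Longrightarrow> word_eq R u v"

definition word_class :: "('x word \<times> 'x word) set \<Rightarrow> 'x word \<Rightarrow> 'x word set" where
  "word_class R u = {v. word_eq R u v}"

definition presented_group :: "('x word \<times> 'x word) set \<Rightarrow> 'x word set monoid" where
  "presented_group R =
    \<lparr>carrier = range (word_class R),
     mult = (\<lambda>X Y. \<Union>u\<in>X. \<Union>v\<in>Y. word_class R (u @ v)),
     one = word_class R []\<rparr>"

definition word_inv :: "'x word \<Rightarrow> 'x word" where
  "word_inv u = rev (map (\<lambda>(x, b). (x, \<not> b)) u)"

definition word_commutator :: "'x word \<Rightarrow> 'x word \<Rightarrow> 'x word" where
  "word_commutator u v = u @ v @ word_inv u @ word_inv v"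

lemma word_class_eq_iff: "word_class R u = word_class R v \<longleftrightarrow> word_eq R u v"
  unfolding word_class_def using word_eq.refl word_eq.sym word_eq.trans by (metis Collect_cong mem_Collect_eq)

lemma presented_group_mult:
  "word_class R u \<otimes>\<^bsub>presented_group R\<^esub> word_class R v = word_class R (u @ v)"
proof -
  have "word_class R (u' @ v') = word_class R (u @ v)"
    if "u' \<in> word_class R u" "v' \<in> word_class R v" for u' v'
    using that unfolding word_class_eq_iff
    by (simp add: word_class_def word_eq.sym[OF word_eq.append])
  then have "(\<Union>u'\<in>word_class R u. \<Union>v'\<in>word_class R v. word_class R (u' @ v')) =
      (\<Union>u'\<in>word_class R u. \<Union>v'\<in>word_class R v. word_class R (u @ v))"
    by (intro SUP_cong HOL.refl)
  moreover have "word_class R u \<noteq> {}" "word_class R v \<noteq> {}"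
    using word_eq.refl[of R u] word_eq.refl[of R v] unfolding word_class_def by blast+
  ultimately show ?thesis
    by (simp add: presented_group_def)
qed

lemma word_eq_word_inv: "word_eq R (word_inv u @ u) []"
proof (induction u)
  case Nil
  show ?case by (simp add: word_inv_def word_eq.refl)
next
  case (Cons a u)
  obtain x b where a: "a = (x, b)" by (cases a)
  have "word_eq R (([(x, \<not> b), (x, b)]) @ u) ([] @ u)"
    using word_eq.cancel[of R x "\<not> b"] by (intro word_eq.append word_eq.refl) simp
  then have "word_eq R (word_inv u @ ([(x, \<not> b), (x, b)] @ u)) (word_inv u @ ([] @ u))"
    by (rule word_eq.append[OF word_eq.refl])
  then show ?case
    using word_eq.trans[OF _ Cons.IH] by (simp add: word_inv_def a)
qed

lemma presented_group_group: "group (presented_group R)"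
proof (rule groupI)
  fix X assume "X \<in> carrier (presented_group R)"
  then obtain u where u: "X = word_class R u" by (auto simp: presented_group_def)
  have "word_class R (word_inv u) \<otimes>\<^bsub>presented_group R\<^esub> X = \<one>\<^bsub>presented_group R\<^esub>"
    unfolding u presented_group_mult by (simp add: presented_group_def word_class_eq_iff word_eq_word_inv)
  then show "\<exists>Y\<in>carrier (presented_group R). Y \<otimes>\<^bsub>presented_group R\<^esub> X = \<one>\<^bsub>presented_group R\<^esub>"
    by (auto simp: presented_group_def)
next
  fix X assume "X \<in> carrier (presented_group R)"
  then obtain u where u: "X = word_class R u" by (auto simp: presented_group_def)
  show "\<one>\<^bsub>presented_group R\<^esub> \<otimes>\<^bsub>presented_group R\<^esub> X = X"
    using presented_group_mult[of R "[]" u] by (simp add: u presented_group_def)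
next
  fix X Y assume "X \<in> carrier (presented_group R)" "Y \<in> carrier (presented_group R)"
  then obtain u v where "X = word_class R u" "Y = word_class R v"
    by (auto simp: presented_group_def)
  then show "X \<otimes>\<^bsub>presented_group R\<^esub> Y \<in> carrier (presented_group R)"
    by (simp add: presented_group_mult) (simp add: presented_group_def)
next
  fix X Y Z
  assume "X \<in> carrier (presented_group R)" "Y \<in> carrier (presented_group R)"
    "Z \<in> carrier (presented_group R)"
  then obtain u v w where "X = word_class R u" "Y = word_class R v" "Z = word_class R w"
    by (auto simp: presented_group_def)
  then show "X \<otimes>\<^bsub>presented_group R\<^esub> Y \<otimes>\<^bsub>presented_group R\<^esub> Z =
      X \<otimes>\<^bsub>presented_group R\<^esub> (Y \<otimes>\<^bsub>presented_group R\<^esub> Z)"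
    by (simp add: presented_group_mult)
qed (simp add: presented_group_def)

fun word_eval :: "('a, 'm) monoid_scheme \<Rightarrow> ('x \<Rightarrow> 'a) \<Rightarrow> 'x word \<Rightarrow> 'a" where
  "word_eval G f [] = \<one>\<^bsub>G\<^esub>"
| "word_eval G f ((x, b) # u) = (if b then f x else inv\<^bsub>G\<^esub> f x) \<otimes>\<^bsub>G\<^esub> word_eval G f u"

theorem presented_group_universal:
  fixes G (structure)
  assumes "group G" and f: "\<And>x. f x \<in> carrier G"
    and R: "\<And>u v. (u, v) \<in> R \<Longrightarrow> word_eval G f u = word_eval G f v"
  shows "\<exists>\<psi> \<in> hom (presented_group R) G. \<forall>u. \<psi> (word_class R u) = word_eval G f u"
proof -
  interpret group G by fact
  have closed: "word_eval G f u \<in> carrier G" for u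
    by (induction u) (auto simp: f)
  have app: "word_eval G f (u @ v) = word_eval G f u \<otimes> word_eval G f v" for u v
    by (induction u) (auto simp: f closed m_assoc)
  have eq: "word_eval G f u = word_eval G f v" if "word_eq R u v" for u v
    using that
  proof induction
    case (rel u v)
    then show ?case by (rule R)
  qed (auto simp: f app)
  define \<psi> where "\<psi> X = word_eval G f (SOME u. X = word_class R u)" for X
  have psi: "\<psi> (word_class R u) = word_eval G f u" for u
  proof -
    have "word_class R u = word_class R (SOME v. word_class R u = word_class R v)"
      by (rule someI) (rule HOL.refl)
    then show ?thesis
      unfolding \<psi>_def by (metis eq word_class_eq_iff)
  qed
  have "\<psi> \<in> hom (presented_group R) G"
  proof (rule homI)
    fix X assume "X \<in> carrier (presented_group R)"
    then show "\<psi> X \<in> carrier G" by (auto simp: presented_group_def psi closed)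
  next
    fix X Y assume "X \<in> carrier (presented_group R)" "Y \<in> carrier (presented_group R)"
    then obtain u v where "X = word_class R u" "Y = word_class R v"
      by (auto simp: presented_group_def)
    then show "\<psi> (X \<otimes>\<^bsub>presented_group R\<^esub> Y) = \<psi> X \<otimes> \<psi> Y"
      by (simp add: presented_group_mult psi app)
  qed
  with psi show ?thesis by blast
qed

section \<open>Higman's group\<close>

text \<open>
  The numeral type \<open>4\<close> of the library is a ring with four elements and arithmetic modulo 4,
  so \<open>i + 1\<close> is the cyclic successor.
\<close>

definition higman_relations :: "(4 word \<times> 4 word) set" where
  "higman_relations =
    {([(i, True)], word_commutator [(i + 1, True)] [(i, True)]) | i :: 4. True}"

definition higman_group :: "4 word set monoid" where
  "higman_group = presented_group higman_relations"

end

theory Submission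
  imports Defs "HOL-Algebra.Generated_Groups" "HOL-Algebra.Multiplicative_Group"
    "HOL-Algebra.Group_Action" "HOL-Number_Theory.Pocklington" "HOL-Library.Countable_Set"
begin

text \<open>
  Let \<open>L(t)\<close> be the normal subgroup generated by the elements of length at most \<open>t\<close> in a finite group
  with a commutator-contractive length, so that \<open>[L(s), L(t)] \<subseteq> L(4st)\<close>. If the \<open>b\<^sub>i\<close> satisfy Higman's
  relations up to \<open>\<eta> \<le> 1/16\<close>, say \<open>b\<^sub>i = e\<^sub>i\<inverse> [b\<^sub>i\<^sub>+\<^sub>1, b\<^sub>i]\<close> with \<open>e\<^sub>i\<close> of length at most \<open>\<eta>\<close>, then they
  satisfy them exactly modulo \<open>L(\<eta>)\<close>; as Higman's group has no nontrivial finite quotient, all \<open>b\<^sub>i\<close> lie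
  in \<open>L(\<eta>)\<close>. Iterating \<open>w\<^sub>i \<mapsto> e\<^sub>i\<inverse> [w\<^sub>i\<^sub>+\<^sub>1, w\<^sub>i]\<close> from \<open>w = \<one>\<close> keeps the lengths of the \<open>w\<^sub>i\<close> below \<open>2\<eta>\<close> and
  improves the congruence \<open>b\<^sub>i \<equiv> w\<^sub>i\<close> from modulo \<open>L(t)\<close> to modulo \<open>L(4\<eta>t)\<close>. Since \<open>L(t)\<close> is trivial for
  small \<open>t\<close>, the \<open>b\<^sub>i\<close> have length at most \<open>2\<eta>\<close>, so an approximation would force the generators
  of Higman's group to be trivial.

  They are not: there are permutations with \<open>b a = a\<^sup>2 b\<close> and \<open>c b = b\<^sup>2 c\<close> such that \<open>a\<close> and \<open>c\<close> are free
  generators by a ping-pong argument. Then some permutation \<open>\<sigma>\<close> of the group they generate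
  conjugates the left multiplications by \<open>a\<close> and \<open>c\<close> into each other, and \<open>a, b, c, \<sigma>b\<sigma>\<inverse>\<close> satisfy
  Higman's relations.
\<close>

section \<open>Solutions of Higman's relations in finite groups\<close>

text \<open>Otherwise let p be the least prime dividing any value of \<open>c\<close>. It divides
  2^n - 1 for some value n of \<open>c\<close>, so the order q of 2 modulo p divides both n and p -
  1, and q is not 1. A prime factor of q is then a smaller prime dividing a value.\<close>

lemma dvd_mersenne_cycle:
  fixes c :: "'i \<Rightarrow> nat"
  assumes nz: "\<And>i. c i \<noteq> 0" and dvd: "\<And>i. c i dvd 2 ^ c (s i) - 1"
  shows "c i = 1"
proof (rule ccontr)
  assume contra: "\<not> ?thesis"
  define P where "P p \<longleftrightarrow> prime p \<and> (\<exists>j. p dvd c j)" for p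
  have "P (Least P)"
  proof -
    obtain p where "prime p" "p dvd c i"
      using contra prime_factor_nat by blast
    then have "P p"
      using contra by (auto simp: P_def)
    then show ?thesis by (rule LeastI)
  qed
  then obtain p j where p: "p = Least P" "prime p" "p dvd c j"
    by (auto simp: P_def)
  have p_dvd: "p dvd 2 ^ c (s j) - 1"
    using p dvd dvd_trans by blast
  have cong: "[2 ^ c (s j) = 1] (mod p)"
    using p_dvd by (metis cong_altdef_nat one_le_numeral one_le_power)
  define q where "q = Pocklington.ord p 2"
  have q_dvd: "q dvd c (s j)"
    unfolding q_def using cong by (rule ord_divides[THEN iffD1])
  \<comment> \<open>\<open>Pocklington.ord p 2\<close> is 0 exactly when p and 2 are not coprime, so
    this excludes p = 2.\<close>
  have "q \<noteq> 0"
    using q_dvd nz[of "s j"] by auto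
  then have coprime: "coprime p 2"
    by (simp add: q_def ord_eq_0)
  have "q dvd p - 1"
    using order_divides_totient[OF coprime] p(2) by (simp only: q_def totient_prime)
  then have "q \<le> p - 1"
    using prime_gt_1_nat[OF p(2)] by (intro dvd_imp_le) auto
  have "q \<noteq> 1"
  proof
    assume "q = 1"
    then have "[2 ^ 1 = 1] (mod p)"
      using ord[of 2 p] by (simp add: q_def)
    then show False
      using prime_gt_1_nat[OF p(2)] by (simp add: cong_altdef_nat)
  qed
  then obtain r where r: "prime r" "r dvd q"
    using prime_factor_nat by blast
  have "P r"
    using r q_dvd dvd_trans by (auto simp: P_def)
  moreover have "r < p"
    using r dvd_imp_le[of r q] \<open>q \<noteq> 0\<close> \<open>q \<le> p - 1\<close> prime_gt_1_nat[OF p(2)] by auto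
  ultimately show False
    using not_less_Least p by blast
qed

text \<open>\<open>rel\<close> is the relation x = [y, x] without inverses: conjugation by
  \<open>y\<close> squares \<open>x\<close>, and this is iterated.\<close>

lemma (in group) conj_square_pow:
  fixes k :: nat
  assumes "x \<in> carrier G" "y \<in> carrier G" and rel: "y \<otimes> x = x \<otimes> x \<otimes> y"
  shows "y [^] k \<otimes> x = x [^] (2 ^ k :: nat) \<otimes> y [^] k"
proof -
  have step: "y \<otimes> x [^] n = x [^] (2 * n) \<otimes> y" for n :: nat
  proof (induction n)
    case (Suc n)
    have "y \<otimes> x [^] Suc n = (y \<otimes> x [^] n) \<otimes> x"
      using assms by (simp add: m_assoc)
    also have "\<dots> = x [^] (2 * n) \<otimes> (y \<otimes> x)"
      unfolding Suc using assms by (simp add: m_assoc)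
    also have "\<dots> = x [^] (2 * Suc n) \<otimes> y"
      unfolding rel using assms by (simp add: m_assoc)
    finally show ?case .
  qed (use assms in simp)
  show ?thesis
  proof (induction k)
    case (Suc k)
    have "y [^] Suc k \<otimes> x = y \<otimes> (y [^] k \<otimes> x)"
      using assms by (simp only: nat_pow_Suc2 m_assoc nat_pow_closed)
    also have "\<dots> = (y \<otimes> x [^] (2 ^ k :: nat)) \<otimes> y [^] k"
      unfolding Suc using assms by (simp add: m_assoc)
    also have "\<dots> = x [^] (2 ^ Suc k :: nat) \<otimes> (y \<otimes> y [^] k)"
      unfolding step using assms by (simp add: m_assoc)
    also have "y \<otimes> y [^] k = y [^] Suc k"
      using assms by (simp only: nat_pow_Suc2)
    finally show ?case .
  qed (use assms in simp)
qed

text \<open>Higman's argument: with k the order of \<open>b (s i)\<close>, conjugation by its k-th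
  power is trivial, so \<open>b i\<close> equals its own 2^k-th power. The orders thus satisfy the
  hypotheses of \<open>dvd_mersenne_cycle\<close>.\<close>

lemma (in group) higman_relations_finite_trivial:
  fixes b :: "'i \<Rightarrow> 'a"
  assumes fin: "finite (carrier G)" and b: "\<And>i. b i \<in> carrier G"
    and rel: "\<And>i. b (s i) \<otimes> b i = b i \<otimes> b i \<otimes> b (s i)"
  shows "b i = \<one>"
proof -
  have pos: "ord (b i) \<noteq> 0" for i
    using ord_ge_1[OF fin b, of i] by simp
  have "ord (b i) dvd 2 ^ ord (b (s i)) - 1" for i
  proof -
    let ?N = "2 ^ ord (b (s i)) :: nat"
    have "b i = b i [^] ?N"
      using conj_square_pow[OF b b rel, of i "ord (b (s i))"] b by simp
    also have "\<dots> = b i [^] (?N - 1) \<otimes> b i"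
      using b by (metis One_nat_def Suc_pred nat_pow_Suc zero_less_numeral zero_less_power)
    finally have "b i [^] (?N - 1) = \<one>"
      using b by (metis nat_pow_closed r_cancel_one)
    then show ?thesis
      using b pow_eq_id by blast
  qed
  then have "ord (b i) = 1"
    using dvd_mersenne_cycle[of "\<lambda>i. ord (b i)" s i] pos by blast
  then show ?thesis
    using ord_eq_1 b by blast
qed


section \<open>Almost solutions in finite groups with a commutator-contractive length\<close>

lemma (in group) commute_generate:
  assumes "S \<subseteq> carrier G" "x \<in> carrier G" and comm: "\<And>s. s \<in> S \<Longrightarrow> x \<otimes> s = s \<otimes> x"
    and y: "y \<in> generate G S"
  shows "x \<otimes> y = y \<otimes> x"
  using y
proof (induction y rule: generate.induct)
  case (inv h)
  then have h: "h \<in> carrier G"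
    using assms(1) by blast
  have "inv h \<otimes> (x \<otimes> h) \<otimes> inv h = inv h \<otimes> (h \<otimes> x) \<otimes> inv h"
    using comm[OF inv] by simp
  also have "\<dots> = x \<otimes> inv h"
    using h assms(2) by (simp add: m_assoc[symmetric])
  also have "inv h \<otimes> (x \<otimes> h) \<otimes> inv h = inv h \<otimes> x"
    using h assms(2) by (simp add: m_assoc)
  finally show ?case ..
next
  case (eng h k)
  then have "h \<in> carrier G" "k \<in> carrier G"
    using generate_in_carrier assms(1) by blast+
  then show ?case
    using eng.IH assms(2) by (metis m_assoc)
qed (use assms comm in auto)

text \<open>Applied in a quotient, this passes from commutators of short elements to the subgroups
  that they generate.\<close>

lemma (in group) commute_generate2:
  assumes "S \<subseteq> carrier G" "T \<subseteq> carrier G" and "\<And>s t. s \<in> S \<Longrightarrow> t \<in> T \<Longrightarrow> s \<otimes> t = t \<otimes> s"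
    and x: "x \<in> generate G S" and y: "y \<in> generate G T"
  shows "x \<otimes> y = y \<otimes> x"
proof (rule commute_generate[OF assms(2) _ _ y])
  show "x \<in> carrier G"
    using generate_in_carrier assms(1) x by blast
  show "x \<otimes> t = t \<otimes> x" if "t \<in> T" for t
    using that assms(2) by (intro commute_generate[OF assms(1) _ _ x, symmetric]) (auto intro: assms(3)[symmetric])
qed

section \<open>Commutators and cosets of normal subgroups\<close>

lemma (in group) inv_mult_eq_one_iff:
  assumes "x \<in> carrier G" "y \<in> carrier G"
  shows "inv x \<otimes> y = \<one> \<longleftrightarrow> x = y"
  using assms inv_solve_left'[of "\<one>" x y] by auto

lemma (in group) commutator_eq_one_iff:
  assumes "x \<in> carrier G" "y \<in> carrier G"
  shows "commutator G x y = \<one> \<longleftrightarrow> x \<otimes> y = y \<otimes> x"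
proof -
  have "commutator G x y = (x \<otimes> y) \<otimes> inv (y \<otimes> x)"
    using assms by (simp add: commutator_def inv_mult_group m_assoc)
  then show ?thesis
    using assms inv_solve_right'[of "\<one>" "x \<otimes> y" "y \<otimes> x"] by auto
qed

text \<open>Since [x, y] = (x y) (y x)^-1, it is enough that both products can be made to end in
  \<open>l \<otimes> l'\<close>, which then cancels.\<close>

lemma (in group) commutator_mult_central:
  assumes carrier: "w \<in> carrier G" "l \<in> carrier G" "w' \<in> carrier G" "l' \<in> carrier G"
    and comm: "l \<otimes> w' = w' \<otimes> l" "l' \<otimes> w = w \<otimes> l'" "l \<otimes> l' = l' \<otimes> l"
  shows "commutator G (w \<otimes> l) (w' \<otimes> l') = commutator G w w'"
proof -
  have c: "commutator G x y = (x \<otimes> y) \<otimes> inv (y \<otimes> x)"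
    if "x \<in> carrier G" "y \<in> carrier G" for x y
    using that by (simp add: commutator_def inv_mult_group m_assoc)
  have 1: "(w \<otimes> l) \<otimes> (w' \<otimes> l') = (w \<otimes> w') \<otimes> (l \<otimes> l')"
    using carrier comm by (metis m_assoc m_closed)
  have 2: "(w' \<otimes> l') \<otimes> (w \<otimes> l) = (w' \<otimes> w) \<otimes> (l \<otimes> l')"
    using carrier comm by (metis m_assoc m_closed)
  have "commutator G (w \<otimes> l) (w' \<otimes> l')
      = ((w \<otimes> w') \<otimes> (l \<otimes> l')) \<otimes> inv ((w' \<otimes> w) \<otimes> (l \<otimes> l'))"
    using carrier by (simp add: c 1 2 del: inv_mult_group)
  also have "\<dots> = (w \<otimes> w') \<otimes> ((l \<otimes> l') \<otimes> inv (l \<otimes> l')) \<otimes> inv (w' \<otimes> w)"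
    using carrier by (simp add: inv_mult_group m_assoc del: r_inv)
  finally show ?thesis
    using carrier by (simp add: c)
qed

lemma (in group_hom) hom_commutator:
  assumes "x \<in> carrier G" "y \<in> carrier G"
  shows "h (commutator G x y) = commutator H (h x) (h y)"
  using assms by (simp add: commutator_def)

lemma (in group) commutator_closed [simp]:
  "x \<in> carrier G \<Longrightarrow> y \<in> carrier G \<Longrightarrow> commutator G x y \<in> carrier G"
  by (simp add: commutator_def)

lemma (in normal) group_hom_Mod: "group_hom G (G Mod H) ((#>) H)"
  using r_coset_hom_Mod factorgroup_is_group is_group
  by (simp add: group_hom_def group_hom_axioms_def)

lemma (in normal) r_coset_eq_iff:
  assumes "x \<in> carrier G" "y \<in> carrier G"
  shows "H #> x = H #> y \<longleftrightarrow> inv x \<otimes> y \<in> H"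
proof -
  interpret \<pi>: group_hom G "G Mod H" "(#>) H"
    by (rule group_hom_Mod)
  have "inv x \<otimes> y \<in> H \<longleftrightarrow> H #> (inv x \<otimes> y) = H"
    using assms by (metis coset_join1 coset_join2 inv_closed m_closed subgroup_axioms subset)
  also have "H #> (inv x \<otimes> y) = inv\<^bsub>G Mod H\<^esub> (H #> x) \<otimes>\<^bsub>G Mod H\<^esub> (H #> y)"
    using assms by (metis \<pi>.hom_inv \<pi>.hom_mult inv_closed)
  also have "\<dots> = H \<longleftrightarrow> H #> x = H #> y"
    using assms \<pi>.H.inv_mult_eq_one_iff[of "H #> x" "H #> y"] \<pi>.hom_closed by simp
  finally show ?thesis by simp
qed

section \<open>Subgroups generated by balls\<close>

locale finite_cc_group = invariant_length +
  assumes finite: "finite (carrier G)" and contractive: "commutator_contractive G len"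
begin

lemma len_one [simp]: "len \<one> = 0"
  using len_eq_0_iff by blast

lemma len_nonneg: "x \<in> carrier G \<Longrightarrow> 0 \<le> len x"
  using len_range by fastforce

lemma len_commutator_le:
  "x \<in> carrier G \<Longrightarrow> y \<in> carrier G \<Longrightarrow> len (commutator G x y) \<le> 4 * len x * len y"
  using contractive by (simp add: commutator_contractive_def)

lemma len_conj:
  assumes "g \<in> carrier G" "x \<in> carrier G"
  shows "len (g \<otimes> x \<otimes> inv g) = len x"
proof -
  have "len (g \<otimes> x \<otimes> inv g) = len (inv g \<otimes> (g \<otimes> x))"
    using assms by (intro len_mult_commute) simp_all
  also have "inv g \<otimes> (g \<otimes> x) = x"
    using assms by (simp add: m_assoc[symmetric])
  finally show ?thesis .
qed

text \<open>This is L(t); its elements may be longer than \<open>t\<close>. No conjugates have to be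
  added, as conjugation preserves the length.\<close>

definition ball_group :: "real \<Rightarrow> 'a set" where
  "ball_group t = generate G {x \<in> carrier G. len x \<le> t}"

lemma normal_ball_group: "ball_group t \<lhd> G"
  unfolding ball_group_def by (rule normal_generateI) (auto simp: len_conj)

lemma subgroup_ball_group: "subgroup (ball_group t) G"
  using normal_ball_group normal_imp_subgroup by blast

lemma ball_group_closed: "x \<in> ball_group t \<Longrightarrow> x \<in> carrier G"
  by (rule subgroup.mem_carrier[OF subgroup_ball_group])

lemma ball_group_incl: "x \<in> carrier G \<Longrightarrow> len x \<le> t \<Longrightarrow> x \<in> ball_group t"
  unfolding ball_group_def by (rule generate.incl) simp

lemma ball_group_mono: "s \<le> t \<Longrightarrow> ball_group s \<subseteq> ball_group t"
  unfolding ball_group_def by (rule mono_generate) auto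

text \<open>This is [L(s), L(t)] \<subseteq> L(4st), phrased as commutation in the quotient:
  contractivity gives it for the generators, and there commutation extends to the generated
  subgroups.\<close>

lemma ball_group_commute:
  assumes "0 \<le> s" "0 \<le> t" and x: "x \<in> ball_group s" and y: "y \<in> ball_group t"
  shows "(ball_group (4 * s * t) #> x) \<otimes>\<^bsub>G Mod ball_group (4 * s * t)\<^esub> (ball_group (4 * s * t) #> y)
    = (ball_group (4 * s * t) #> y) \<otimes>\<^bsub>G Mod ball_group (4 * s * t)\<^esub> (ball_group (4 * s * t) #> x)"
proof -
  let ?M = "ball_group (4 * s * t)"
  interpret M: normal ?M G by (rule normal_ball_group)
  interpret \<pi>: group_hom G "G Mod ?M" "(#>) ?M" by (rule M.group_hom_Mod)
  let ?B = "\<lambda>t. {x \<in> carrier G. len x \<le> t}"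
  have gen: "?M #> z \<in> generate (G Mod ?M) ((#>) ?M ` ?B r)" if "z \<in> ball_group r" for z r
    using that \<pi>.generate_img[of "?B r"] by (auto simp: ball_group_def)
  have "a \<otimes>\<^bsub>G Mod ?M\<^esub> b = b \<otimes>\<^bsub>G Mod ?M\<^esub> a"
    if a: "a \<in> (#>) ?M ` ?B s" and b: "b \<in> (#>) ?M ` ?B t" for a b
  proof -
    obtain a' b' where ab: "a = ?M #> a'" "b = ?M #> b'" "a' \<in> carrier G" "b' \<in> carrier G"
      "len a' \<le> s" "len b' \<le> t"
      using a b by auto
    have "len (commutator G a' b') \<le> 4 * len a' * len b'"
      using ab by (intro len_commutator_le)
    also have "\<dots> \<le> 4 * s * t"
      using ab assms len_nonneg by (intro mult_mono) auto
    finally have "commutator G a' b' \<in> ?M"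
      using ab by (intro ball_group_incl) simp_all
    then have "commutator (G Mod ?M) a b = \<one>\<^bsub>G Mod ?M\<^esub>"
      using ab M.rcos_const[OF is_group] by (simp flip: \<pi>.hom_commutator)
    then show ?thesis
      using \<pi>.H.commutator_eq_one_iff ab \<pi>.hom_closed by blast
  qed
  then show ?thesis
    using \<pi>.hom_closed
    by (intro \<pi>.H.commute_generate2[OF _ _ _ gen[OF x] gen[OF y]]) auto
qed

lemma ball_group_trivial:
  obtains t where "t > 0" "ball_group t = {\<one>}"
proof -
  \<comment> \<open>The inserted 1 covers the trivial group. Balls are closed, so the radius will be
    half of this minimum.\<close>
  define T where "T = Min (insert 1 (len ` (carrier G - {\<one>})))"
  have fin: "finite (insert 1 (len ` (carrier G - {\<one>})))"
    using finite by simp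
  have "T > 0"
    unfolding T_def using fin len_nonneg len_eq_0_iff by (subst Min_gr_iff) (force simp: order.order_iff_strict)+
  have "{x \<in> carrier G. len x \<le> T / 2} = {\<one>}"
  proof -
    have "x = \<one>" if "x \<in> carrier G" "len x \<le> T / 2" for x
    proof (rule ccontr)
      assume "x \<noteq> \<one>"
      then have "T \<le> len x"
        unfolding T_def using that fin by (intro Min_le) auto
      then show False using that \<open>T > 0\<close> by simp
    qed
    then show ?thesis using \<open>T > 0\<close> by auto
  qed
  then show ?thesis
    using that[of "T / 2"] \<open>T > 0\<close> generate_one by (simp add: ball_group_def)
qed

text \<open>Write x = w l and y = v m with l, m in L(t). Modulo L(4st) both commute with all of
  L(s), and t \<le> s puts l in L(s), so they also commute with each other.\<close>

lemma mod_commutator_cong: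
  assumes "0 \<le> s" "0 \<le> t" "t \<le> s"
    and x: "x \<in> ball_group s" "w \<in> ball_group s" "inv w \<otimes> x \<in> ball_group t"
    and y: "y \<in> ball_group s" "v \<in> ball_group s" "inv v \<otimes> y \<in> ball_group t"
  shows "inv (commutator G w v) \<otimes> commutator G x y \<in> ball_group (4 * s * t)"
proof -
  let ?M = "ball_group (4 * s * t)"
  interpret M: normal ?M G by (rule normal_ball_group)
  interpret \<pi>: group_hom G "G Mod ?M" "(#>) ?M" by (rule M.group_hom_Mod)
  define l m where "l = inv w \<otimes> x" and "m = inv v \<otimes> y"
  have car: "x \<in> carrier G" "w \<in> carrier G" "y \<in> carrier G" "v \<in> carrier G"
    "l \<in> carrier G" "m \<in> carrier G"
    using x y by (auto simp: l_def m_def dest: ball_group_closed)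
  have "x = w \<otimes> l" "y = v \<otimes> m"
    using car by (auto simp: l_def m_def m_assoc[symmetric])
  moreover have l: "l \<in> ball_group t" "l \<in> ball_group s" and m: "m \<in> ball_group t"
    using x y ball_group_mono[OF assms(3)] by (auto simp: l_def m_def)
  ultimately have "?M #> commutator G x y = ?M #> commutator G w v"
    using car ball_group_commute[OF assms(1,2) y(2) l(1)] ball_group_commute[OF assms(1,2) x(2) m]
      ball_group_commute[OF assms(1,2) l(2) m]
    by (simp add: \<pi>.hom_commutator \<pi>.H.commutator_mult_central del: mult_FactGroup)
  then show ?thesis
    using car by (metis M.r_coset_eq_iff commutator_closed)
qed

text \<open>The bound is the same for all groups and lengths. The constant 1/16 gives 4 (2 \<eta>)^2
  \<le> \<eta>, which keeps the approximants short, and 4 \<eta> < 1, which makes the congruences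
  improve.\<close>

theorem almost_higman_relations_small:
  fixes b :: "'i \<Rightarrow> 'a"
  assumes b: "\<And>i. b i \<in> carrier G" and \<eta>: "0 \<le> \<eta>" "\<eta> \<le> 1 / 16"
    and defect: "\<And>i. len (commutator G (b (s i)) (b i) \<otimes> inv b i) \<le> \<eta>"
  shows "len (b i) \<le> 2 * \<eta>"
proof -
  define e where "e i = commutator G (b (s i)) (b i) \<otimes> inv b i" for i
  have e_car: "e i \<in> carrier G" for i
    using b by (simp add: e_def)
  have len_e: "len (e i) \<le> \<eta>" for i
    using defect by (simp add: e_def)
  have e: "e i \<in> ball_group \<eta>" "inv e i \<in> ball_group \<eta>" for i
    using e_car len_e by (simp_all add: len_inv ball_group_incl)
  \<comment> \<open>Modulo L(\<eta>) the defects \<open>e i\<close> vanish, so the images of the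
    \<open>b i\<close> solve the relations exactly in a finite group.\<close>
  have b_ball: "b i \<in> ball_group \<eta>" for i
  proof -
    let ?N = "ball_group \<eta>"
    interpret M: normal ?N G by (rule normal_ball_group)
    interpret \<pi>: group_hom G "G Mod ?N" "(#>) ?N" by (rule M.group_hom_Mod)
    have rel: "(?N #> b (s i)) \<otimes>\<^bsub>G Mod ?N\<^esub> (?N #> b i)
        = (?N #> b i) \<otimes>\<^bsub>G Mod ?N\<^esub> (?N #> b i) \<otimes>\<^bsub>G Mod ?N\<^esub> (?N #> b (s i))" for i
    proof -
      have car: "b i \<otimes> b i \<otimes> b (s i) \<in> carrier G" "b (s i) \<otimes> b i \<in> carrier G"
        using b by simp_all
      have "e i = (b (s i) \<otimes> b i) \<otimes> inv (b i \<otimes> b i \<otimes> b (s i))"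
        using b[of i] b[of "s i"] by (simp add: e_def commutator_def m_assoc inv_mult_group)
      then have "b (s i) \<otimes> b i = e i \<otimes> (b i \<otimes> b i \<otimes> b (s i))"
        using inv_solve_right[OF e_car car(2,1)] by metis
      then have "?N #> (b (s i) \<otimes> b i) = (?N #> e i) #> (b i \<otimes> b i \<otimes> b (s i))"
        using coset_mult_assoc[OF M.subset e_car car(1)] by metis
      also have "?N #> e i = ?N"
        by (rule M.rcos_const[OF is_group e(1)])
      finally show ?thesis
        unfolding \<pi>.hom_mult[OF b b, symmetric] \<pi>.hom_mult[OF m_closed[OF b b] b, symmetric] .
    qed
    have fin: "finite (carrier (G Mod ?N))"
      using finite by (simp add: carrier_FactGroup)
    have "?N #> b i = \<one>\<^bsub>G Mod ?N\<^esub>"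
      using \<pi>.H.higman_relations_finite_trivial[where s = s and b = "\<lambda>i. ?N #> b i",
          OF fin \<pi>.hom_closed[OF b] rel] .
    then show ?thesis
      using rcos_self[OF b M.subgroup_axioms, of i] by simp
  qed
  \<comment> \<open>Membership in \<open>ball_group \<eta>\<close> does not bound the length of
    \<open>b i\<close>; the approximants \<open>w i\<close> carry a length bound instead.\<close>
  have approx: "\<exists>w. \<forall>i. w i \<in> ball_group \<eta> \<and> len (w i) \<le> 2 * \<eta> \<and>
      inv w i \<otimes> b i \<in> ball_group (\<eta> * (4 * \<eta>) ^ n)" for n
  proof (induction n)
    case 0
    show ?case
      using b b_ball \<eta> subgroup.one_closed[OF subgroup_ball_group] by (intro exI[of _ "\<lambda>_. \<one>"]) simp
  next
    case (Suc n)
    then obtain w where w: "\<And>i. w i \<in> ball_group \<eta>" "\<And>i. len (w i) \<le> 2 * \<eta>"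
      "\<And>i. inv w i \<otimes> b i \<in> ball_group (\<eta> * (4 * \<eta>) ^ n)"
      by blast
    have w_car: "w i \<in> carrier G" for i
      using w(1) ball_group_closed by blast
    let ?t = "\<eta> * (4 * \<eta>) ^ n"
    have t: "0 \<le> ?t" "?t \<le> \<eta>"
      using \<eta> mult_left_le[OF power_le_one[of "4 * \<eta>" n], of \<eta>] by simp_all
    \<comment> \<open>\<open>b\<close> is a fixed point of this map, so \<open>inv e i\<close> drops
      out of the comparison with \<open>b i\<close>, and comparing the commutators gains the factor
      4 \<eta>.\<close>
    define v where "v i = inv e i \<otimes> commutator G (w (s i)) (w i)" for i
    have "v i \<in> ball_group \<eta>" for i
      using e w(1) subgroup.m_closed[OF subgroup_ball_group] subgroup.m_inv_closed[OF subgroup_ball_group]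
      by (simp add: v_def commutator_def)
    moreover have "len (v i) \<le> 2 * \<eta>" for i
    proof -
      have "len (v i) \<le> len (inv e i) + len (commutator G (w (s i)) (w i))"
        unfolding v_def using e_car w_car by (intro len_mult_le) simp_all
      also have "len (inv e i) \<le> \<eta>"
        using e_car len_e by (simp add: len_inv)
      also have "len (commutator G (w (s i)) (w i)) \<le> 4 * len (w (s i)) * len (w i)"
        using w_car by (intro len_commutator_le)
      also have "\<dots> \<le> 4 * (2 * \<eta>) * (2 * \<eta>)"
        using w w_car len_nonneg \<eta> by (intro mult_mono) auto
      also have "\<dots> = 16 * \<eta> * \<eta>" by simp
      also have "\<dots> \<le> \<eta>"
        using mult_right_mono[of "16 * \<eta>" 1 \<eta>] \<eta> by simp
      finally show ?thesis by simp
    qed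
    moreover have "inv v i \<otimes> b i \<in> ball_group (\<eta> * (4 * \<eta>) ^ Suc n)" for i
    proof -
      have "inv v i \<otimes> b i = inv (commutator G (w (s i)) (w i)) \<otimes> (e i \<otimes> b i)"
        using e_car w_car b by (simp add: v_def inv_mult_group m_assoc)
      also have "e i \<otimes> b i = commutator G (b (s i)) (b i)"
        using b by (simp add: e_def m_assoc)
      finally show ?thesis
        using mod_commutator_cong[OF \<eta>(1) t b_ball w(1) w(3) b_ball w(1) w(3), of "s i" i]
        by (simp add: mult_ac)
    qed
    ultimately show ?case by blast
  qed
  \<comment> \<open>For large n the congruence is modulo the trivial subgroup and becomes
    \<open>b i = w i\<close>.\<close>
  obtain t where t: "t > 0" "ball_group t = {\<one>}"
    by (rule ball_group_trivial)
  have "(\<lambda>n. \<eta> * (4 * \<eta>) ^ n) \<longlonglongrightarrow> \<eta> * 0"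
    using \<eta> by (intro tendsto_mult tendsto_const LIMSEQ_power_zero) simp
  then have "\<forall>\<^sub>F n in sequentially. \<eta> * (4 * \<eta>) ^ n < t"
    using t by (intro order_tendstoD) simp
  then obtain n where "\<eta> * (4 * \<eta>) ^ n \<le> t"
    by (meson eventually_happens' less_imp_le sequentially_bot)
  with approx[of n] obtain w where w: "w i \<in> ball_group \<eta>" "len (w i) \<le> 2 * \<eta>" "inv w i \<otimes> b i = \<one>"
    using ball_group_mono t by blast
  then have "b i = w i"
    using b ball_group_closed inv_mult_eq_one_iff by metis
  with w show ?thesis by simp
qed

end

section \<open>Evaluation of words\<close>

lemma (in group) word_eval_closed:
  "(\<And>x. f x \<in> carrier G) \<Longrightarrow> word_eval G f w \<in> carrier G"
  by (induction w) auto

lemma (in group) word_eval_append: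
  assumes "\<And>x. f x \<in> carrier G"
  shows "word_eval G f (u @ v) = word_eval G f u \<otimes> word_eval G f v"
  by (induction u) (auto simp: assms word_eval_closed m_assoc)

lemma (in group) word_eval_cong:
  assumes "\<And>x. f x \<in> carrier G"
    and "\<And>u v. (u, v) \<in> R \<Longrightarrow> word_eval G f u = word_eval G f v" and "word_eq R u v"
  shows "word_eval G f u = word_eval G f v"
proof -
  obtain \<psi> where "\<And>u. \<psi> (word_class R u) = word_eval G f u"
    using presented_group_universal[OF is_group, of f R] assms by blast
  then show ?thesis
    using assms(3) word_class_eq_iff by metis
qed

lemma (in group) word_eval_eq_iff:
  assumes f: "\<And>x. f x \<in> carrier G"
  shows "word_eval G f u = word_eval G f v \<longleftrightarrow> word_eval G f (word_inv v @ u) = \<one>"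
proof -
  have "word_eval G f (word_inv v) \<otimes> word_eval G f v = \<one>"
    using word_eval_cong[OF f _ word_eq_word_inv[of "{}" v]] by (simp add: f word_eval_append)
  then have "word_eval G f (word_inv v) = inv (word_eval G f v)"
    using f word_eval_closed by (metis inv_equality)
  then show ?thesis
    using inv_mult_eq_one_iff[of "word_eval G f v" "word_eval G f u"] word_eval_closed[where f = f, OF f]
    by (auto simp: word_eval_append[where f = f, OF f])
qed

section \<open>Ping-pong\<close>

definition cancellable :: "'x word \<Rightarrow> bool" where
  "cancellable w \<longleftrightarrow> (\<exists>u x b v. w = u @ [(x, b), (x, \<not> b)] @ v)"

lemma cancellable_Cons: "cancellable w \<Longrightarrow> cancellable (l # w)"
  unfolding cancellable_def by (metis append_Cons)

lemma cancellable_Cons_Cons: "b \<noteq> c \<Longrightarrow> cancellable ((x, b) # (x, c) # w)"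
  unfolding cancellable_def by (rule exI[of _ "[]"]) auto

text \<open>Signs encode the ping-pong sets: \<open>N i\<close> is positive on the set of
  \<open>f i\<close> and negative on that of its inverse, \<open>exclusive\<close> makes the sets of
  different generators disjoint, and \<open>z\<close> lies in none of them.\<close>

locale ping_pong = group_action G E \<phi> for G (structure) and E :: "'b set" and \<phi> +
  fixes f :: "'x \<Rightarrow> 'a" and N :: "'x \<Rightarrow> 'b \<Rightarrow> 'r :: {linorder, zero}" and z :: 'b
  assumes f_closed: "f i \<in> carrier G"
    and increasing: "p \<in> E \<Longrightarrow> N i p < N i (\<phi> (f i) p)"
    and exclusive: "p \<in> E \<Longrightarrow> i \<noteq> j \<Longrightarrow> N i p \<noteq> 0 \<Longrightarrow> N j p = 0"
    and base: "z \<in> E" "N i z = 0"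
begin

sublocale group G
  using group_hom by (simp add: group_hom_def)

lemma decreasing:
  assumes "p \<in> E"
  shows "N i (\<phi> (inv f i) p) < N i p"
proof -
  have "\<phi> (inv f i) p \<in> E"
    using assms element_image f_closed by blast
  moreover have "\<phi> (f i) (\<phi> (inv f i) p) = p"
    using assms f_closed composition_rule[of p "f i" "inv f i"] id_eq_one by (metis inv_closed r_inv restrict_apply')
  ultimately show ?thesis
    using increasing by metis
qed

text \<open>When a reduced word acts on \<open>z\<close>, a strict sign at the image point records
  its first letter. The disjunct on cancellation lets the induction run over all words.\<close>

lemma sign_word_eval:
  "cancellable w \<or> w = [] \<or> (case hd w of (x, b) \<Rightarrow>
    if b then N x (\<phi> (word_eval G f w) z) > 0 else N x (\<phi> (word_eval G f w) z) < 0)"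
proof (induction w)
  case (Cons l w)
  obtain x b where l: "l = (x, b)" by (cases l)
  define p where "p = \<phi> (word_eval G f w) z"
  have w_closed: "word_eval G f w \<in> carrier G"
    using f_closed by (rule word_eval_closed)
  have p: "p \<in> E"
    using base w_closed element_image unfolding p_def by blast
  show ?case
  proof (cases "cancellable (l # w)")
    case False
    then have w: "\<not> cancellable w"
      using cancellable_Cons by blast
    \<comment> \<open>Only a following inverse letter could put \<open>p\<close> strictly on the
      wrong side; the letter now moves it strictly outwards.\<close>
    have sign: "if b then 0 \<le> N x p else N x p \<le> 0"
    proof (cases w)
      case Nil
      then have "p = z"
        using base id_eq_one by (metis p_def restrict_apply' word_eval.simps(1))
      then show ?thesis
        using base by simp
    next
      case (Cons l' w')
      obtain y c where l': "l' = (y, c)" by (cases l')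
      have y: "if c then N y p > 0 else N y p < 0"
        using Cons.IH w unfolding Cons l' p_def by simp
      show ?thesis
      proof (cases "y = x")
        case True
        then have "c = b"
          using False Cons l l' cancellable_Cons_Cons by metis
        then show ?thesis
          using y True by (auto split: if_splits)
      next
        case False
        then have "N x p = 0"
          using y p exclusive[of p y x] by (auto split: if_splits)
        then show ?thesis by simp
      qed
    qed
    have "\<phi> (word_eval G f (l # w)) z = \<phi> (if b then f x else inv f x) p"
      using base w_closed f_closed composition_rule by (simp add: l p_def)
    then show ?thesis
      using sign p increasing[of p x] decreasing[of p x] by (auto simp: l)
  qed simp
qed simp

text \<open>Cancelling pairs are deleted until the word is reduced; a nonempty reduced word gives
  \<open>z\<close> a nonzero coordinate and so moves it.\<close>

theorem word_eval_one_imp: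
  "word_eval G f w = \<one> \<Longrightarrow> word_eq {} w []"
proof (induction w rule: length_induct)
  case (1 w)
  show ?case
  proof (cases "cancellable w")
    case True
    then obtain u x b v where w: "w = u @ [(x, b), (x, \<not> b)] @ v"
      unfolding cancellable_def by blast
    have eq: "word_eq {} w (u @ v)"
      using word_eq.append[OF word_eq.refl word_eq.append[OF word_eq.cancel word_eq.refl], of "{}" u x b v]
      by (simp add: w)
    then have "word_eval G f (u @ v) = \<one>"
      using word_eval_cong[OF f_closed _ eq] 1 by simp
    then have "word_eq {} (u @ v) []"
      using 1 by (simp add: w)
    then show ?thesis
      using eq word_eq.trans by blast
  next
    case False
    have "\<phi> (word_eval G f w) z = z"
      using 1 base id_eq_one by (metis restrict_apply')
    then have "w = []"
      using sign_word_eval[of w] False base by (auto split: if_splits prod.splits)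
    then show ?thesis
      by (simp add: word_eq.refl)
  qed
qed

end

lemma word_eval_map_generators:
  "word_eval G f (map (apfst g) w) = word_eval G (f \<circ> g) w"
  by (induction w) auto

text \<open>
  Left multiplication by the free subgroup is a free action, so the automorphism swapping the free
  generators extends to a permutation of the whole group, coset by coset.
\<close>

lemma (in group) swap_free_generators:
  fixes f :: "bool \<Rightarrow> 'a"
  assumes f: "\<And>x. f x \<in> carrier G" and free: "\<And>w. word_eval G f w = \<one> \<Longrightarrow> word_eq {} w []"
  obtains \<sigma> where "\<And>g. g \<in> carrier G \<Longrightarrow> \<sigma> g \<in> carrier G"
    "\<And>g. g \<in> carrier G \<Longrightarrow> \<sigma> (\<sigma> g) = g"
    "\<And>i g. g \<in> carrier G \<Longrightarrow> \<sigma> (f i \<otimes> g) = f (\<not> i) \<otimes> \<sigma> g"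
proof -
  let ?e = "word_eval G f"
  define sw :: "bool word \<Rightarrow> bool word" where "sw = map (apfst Not)"
  have sw_sw: "sw (sw w) = w" for w
    by (induction w) (auto simp: sw_def)
  have sw_append: "sw (u @ v) = sw u @ sw v" for u v
    by (simp add: sw_def)
  have e_sw: "?e (sw w) = word_eval G (f \<circ> Not) w" for w
    by (simp add: sw_def word_eval_map_generators)
  have e_closed [simp]: "?e w \<in> carrier G" for w
    using f by (rule word_eval_closed)
  have e_append: "?e (u @ v) = ?e u \<otimes> ?e v" for u v
    using f by (rule word_eval_append)
  \<comment> \<open>By \<open>free\<close>, words with equal values are equal in the free group, so
    they also agree when evaluated with the generators exchanged.\<close>
  have sw_cong: "?e (sw u) = ?e (sw v)" if "?e u = ?e v" for u v
  proof -
    have f': "(f \<circ> Not) x \<in> carrier G" for x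
      using f by simp
    have "word_eq {} (word_inv v @ u) []"
      using that word_eval_eq_iff[where f = f, OF f] free by blast
    then have "word_eval G (f \<circ> Not) (word_inv v @ u) = \<one>"
      using word_eval_cong[where f = "f \<circ> Not" and R = "{}", OF f'] by simp
    then show ?thesis
      unfolding e_sw word_eval_eq_iff[where f = "f \<circ> Not", OF f'] .
  qed
  \<comment> \<open>The predicate depends only on the right coset of \<open>g\<close>, so
    \<open>rep\<close> is constant on cosets; \<open>\<sigma>\<close> exchanges the letters in front
    of the representative.\<close>
  define rep where "rep g = (SOME h. h \<in> carrier G \<and> (\<exists>w. g = ?e w \<otimes> h))" for g
  define wd where "wd g = (SOME w. g = ?e w \<otimes> rep g)" for g
  define \<sigma> where "\<sigma> g = ?e (sw (wd g)) \<otimes> rep g" for g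
  have "rep g \<in> carrier G \<and> (\<exists>w. g = ?e w \<otimes> rep g)" if "g \<in> carrier G" for g
    unfolding rep_def
    by (rule someI[of _ g]) (use that in \<open>auto intro!: exI[of _ "[]"]\<close>)
  then have rep_closed [simp]: "rep g \<in> carrier G" and ex_wd: "\<exists>w. g = ?e w \<otimes> rep g"
    if "g \<in> carrier G" for g
    using that by blast+
  have wd: "g = ?e (wd g) \<otimes> rep g" if "g \<in> carrier G" for g
    unfolding wd_def by (rule someI_ex) (rule ex_wd[OF that])
  have rep_mult: "rep (?e w \<otimes> g) = rep g" if g: "g \<in> carrier G" for w g
  proof -
    have "(\<exists>u. ?e w \<otimes> g = ?e u \<otimes> h) \<longleftrightarrow> (\<exists>u. g = ?e u \<otimes> h)" if h: "h \<in> carrier G" for h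
    proof
      assume "\<exists>u. ?e w \<otimes> g = ?e u \<otimes> h"
      then obtain u where "?e w \<otimes> g = ?e u \<otimes> h" ..
      then have "?e (word_inv w @ w) \<otimes> g = ?e (word_inv w @ u) \<otimes> h"
        using g h by (simp add: e_append m_assoc)
      moreover have "?e (word_inv w @ w) = \<one>"
        using word_eval_eq_iff[where f = f, OF f] by blast
      ultimately show "\<exists>u. g = ?e u \<otimes> h"
        using g by auto
    next
      assume "\<exists>u. g = ?e u \<otimes> h"
      then obtain u where "g = ?e u \<otimes> h" ..
      then have "?e w \<otimes> g = ?e (w @ u) \<otimes> h"
        using h by (simp add: e_append m_assoc)
      then show "\<exists>u. ?e w \<otimes> g = ?e u \<otimes> h" ..
    qed
    then show ?thesis
      unfolding rep_def by (metis (no_types, lifting))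
  qed
  have \<sigma>_eq: "\<sigma> g = ?e (sw u) \<otimes> rep g" if g: "g \<in> carrier G" and u: "g = ?e u \<otimes> rep g" for g u
  proof -
    have "?e u \<otimes> rep g = ?e (wd g) \<otimes> rep g"
      using wd[OF g] u by simp
    then have "?e u = ?e (wd g)"
      using g by simp
    then show ?thesis
      unfolding \<sigma>_def using sw_cong by metis
  qed
  have closed: "\<sigma> g \<in> carrier G" if "g \<in> carrier G" for g
    using that by (simp add: \<sigma>_def)
  have mult: "\<sigma> (?e w \<otimes> g) = ?e (sw w) \<otimes> \<sigma> g" if g: "g \<in> carrier G" for w g
  proof -
    have "?e w \<otimes> g = ?e (w @ wd g) \<otimes> rep (?e w \<otimes> g)"
      using g wd[OF g] by (simp add: rep_mult e_append m_assoc)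
    then have "\<sigma> (?e w \<otimes> g) = ?e (sw (w @ wd g)) \<otimes> rep (?e w \<otimes> g)"
      using g by (intro \<sigma>_eq) simp_all
    then show ?thesis
      using g by (simp add: rep_mult sw_append e_append m_assoc \<sigma>_def)
  qed
  show thesis
  proof (rule that)
    fix g assume g: "g \<in> carrier G"
    show "\<sigma> g \<in> carrier G"
      using g by (rule closed)
    have "rep (\<sigma> g) = rep g"
      using g rep_mult[of "rep g" "sw (wd g)"] rep_mult[of "rep g" "wd g"] wd[OF g] by (simp add: \<sigma>_def)
    then have "\<sigma> (\<sigma> g) = ?e (sw (sw (wd g))) \<otimes> rep g"
      using \<sigma>_eq[OF closed[OF g], of "sw (wd g)"] by (simp add: \<sigma>_def)
    then show "\<sigma> (\<sigma> g) = g"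
      using wd[OF g] by (simp add: sw_sw)
    show "\<sigma> (f i \<otimes> g) = f (\<not> i) \<otimes> \<sigma> g" for i
      using mult[OF g, of "[(i, True)]"] f by (simp add: sw_def)
  qed
qed

text \<open>The swap is only a permutation of the underlying set, so the group is embedded in the
  permutations of its carrier.\<close>

lemma (in group) left_mult_hom:
  "(\<lambda>g. \<lambda>x\<in>carrier G. g \<otimes> x) \<in> hom G (BijGroup (carrier G))"
proof (rule homI)
  have bij: "(\<lambda>x\<in>carrier G. g \<otimes> x) \<in> Bij (carrier G)" if g: "g \<in> carrier G" for g
  proof -
    have "bij_betw (\<lambda>x. g \<otimes> x) (carrier G) (carrier G)"
      by (rule bij_betw_byWitness[where f' = "\<lambda>x. inv g \<otimes> x"])
        (use g in \<open>auto simp: m_assoc[symmetric]\<close>)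
    then show ?thesis
      by (simp add: Bij_def)
  qed
  then show "(\<lambda>x\<in>carrier G. g \<otimes> x) \<in> carrier (BijGroup (carrier G))" if "g \<in> carrier G" for g
    using that by (simp add: BijGroup_def)
  show "(\<lambda>x\<in>carrier G. g \<otimes> h \<otimes> x) =
      (\<lambda>x\<in>carrier G. g \<otimes> x) \<otimes>\<^bsub>BijGroup (carrier G)\<^esub> (\<lambda>x\<in>carrier G. h \<otimes> x)"
    if "g \<in> carrier G" "h \<in> carrier G" for g h
    using that bij by (auto simp: BijGroup_def compose_def m_assoc intro!: restrict_ext)
qed

section \<open>Higman's group is nontrivial\<close>

text \<open>Conjugation by \<open>s\<close> exchanges \<open>a\<close> and \<open>c\<close> and
  sends \<open>b\<close> to \<open>d\<close>, so it turns the two given relations into the two that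
  close the cycle.\<close>

lemma (in group) higman_extend:
  assumes [simp]: "a \<in> carrier G" "b \<in> carrier G" "c \<in> carrier G" "s \<in> carrier G"
    and ba: "b \<otimes> a = a \<otimes> a \<otimes> b" and cb: "c \<otimes> b = b \<otimes> b \<otimes> c"
    and sa: "s \<otimes> a = c \<otimes> s" and sc: "s \<otimes> c = a \<otimes> s"
  defines "d \<equiv> s \<otimes> b \<otimes> inv s"
  shows "d \<otimes> c = c \<otimes> c \<otimes> d" "a \<otimes> d = d \<otimes> d \<otimes> a"
proof -
  have c: "c = s \<otimes> a \<otimes> inv s" and a: "a = s \<otimes> c \<otimes> inv s"
    using inv_solve_right[of c "s \<otimes> a" s] inv_solve_right[of a "s \<otimes> c" s] by (auto simp: sa sc)
  have conj: "(s \<otimes> x \<otimes> inv s) \<otimes> (s \<otimes> y \<otimes> inv s) = s \<otimes> (x \<otimes> y) \<otimes> inv s"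
    if "x \<in> carrier G" "y \<in> carrier G" for x y
  proof -
    have "inv s \<otimes> (s \<otimes> (y \<otimes> inv s)) = y \<otimes> inv s"
      using that m_assoc[of "inv s" s "y \<otimes> inv s", symmetric] by simp
    then show ?thesis
      using that by (simp add: m_assoc)
  qed
  have "d \<otimes> c = s \<otimes> (b \<otimes> a) \<otimes> inv s"
    unfolding d_def by (subst c) (simp only: conj assms(1-4))
  also have "\<dots> = (s \<otimes> a \<otimes> inv s) \<otimes> (s \<otimes> a \<otimes> inv s) \<otimes> d"
    unfolding d_def by (simp add: ba conj)
  finally show "d \<otimes> c = c \<otimes> c \<otimes> d"
    using c by simp
  have "a \<otimes> d = s \<otimes> (c \<otimes> b) \<otimes> inv s"
    unfolding d_def by (subst a) (simp only: conj assms(1-4))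
  also have "\<dots> = d \<otimes> d \<otimes> (s \<otimes> c \<otimes> inv s)"
    unfolding d_def by (simp add: cb conj)
  finally show "a \<otimes> d = d \<otimes> d \<otimes> a"
    using a by simp
qed

section \<open>Permutations of a countable set\<close>

lemma carrier_BijGroup_UNIV: "carrier (BijGroup UNIV) = {f. bij f}"
  by (simp add: BijGroup_def Bij_def)

lemma mult_BijGroup_UNIV: "bij f \<Longrightarrow> bij g \<Longrightarrow> f \<otimes>\<^bsub>BijGroup UNIV\<^esub> g = f \<circ> g"
  by (auto simp: BijGroup_def Bij_def compose_def restrict_def)

lemma countable_infinite_bij:
  fixes A :: "'a set" and B :: "'b set"
  assumes "countable A" "infinite A" "countable B" "infinite B"
  obtains f where "bij_betw f A B"
proof -
  obtain e :: "'a \<Rightarrow> nat" where "bij_betw e A UNIV"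
    using countableE_infinite assms by blast
  moreover obtain g :: "nat \<Rightarrow> 'b" where "bij_betw g UNIV B"
    using countable_infiniteE' assms by blast
  ultimately show thesis
    using that bij_betw_trans by blast
qed

text \<open>Pairs (u, j) and pairs (fractional part, level) will both label the orbits of a shift.
  The factor \<open>nat\<close> makes u = 0 an infinite set, which is matched with all labels of
  nonzero level and with (0, 0), kept for a base point; the rest goes to level 0.\<close>

lemma orbit_identification:
  obtains \<theta> :: "rat \<times> nat \<Rightarrow> rat \<times> int" and v
  where "bij_betw \<theta> UNIV ({0..<1} \<times> UNIV)" "\<forall>v. snd (\<theta> v) \<noteq> 0 \<longrightarrow> fst v = 0"
    "fst v = 0" "snd (\<theta> v) = 0"
proof -
  let ?A = "{v :: rat \<times> nat. fst v = 0}" and ?A' = "{v :: rat \<times> nat. fst v \<noteq> 0}"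
  let ?B = "insert (0, 0) {p :: rat \<times> int. fst p \<in> {0..<1} \<and> snd p \<noteq> 0}"
  let ?B' = "{0<..<1} \<times> {0} :: (rat \<times> int) set"
  have range_infinite: "infinite S" if "inj h" "range h \<subseteq> S" for S :: "'s set" and h :: "nat \<Rightarrow> 's"
    using that range_inj_infinite infinite_super by blast
  have inf: "infinite ?A" "infinite ?A'" "infinite ?B" "infinite ?B'"
    subgoal by (rule range_infinite[of "\<lambda>n. (0, n)"]) (auto intro!: injI)
    subgoal by (rule range_infinite[of "\<lambda>n. (1, n)"]) (auto intro!: injI)
    subgoal by (rule range_infinite[of "\<lambda>n. (0, int n)"]) (auto intro!: injI)
    subgoal by (rule range_infinite[of "\<lambda>n. (1 / (of_nat n + 2), 0)"]) (auto intro!: injI)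
    done
  obtain f where f: "bij_betw f ?A ?B"
    using countable_infinite_bij[OF _ inf(1) _ inf(3)] by auto
  obtain g where g: "bij_betw g ?A' ?B'"
    using countable_infinite_bij[OF _ inf(2) _ inf(4)] by auto
  define \<theta> where "\<theta> v = (if v \<in> ?A then f v else g v)" for v
  have fA: "bij_betw \<theta> ?A ?B"
    using f by (rule bij_betw_cong[THEN iffD1, rotated]) (simp add: \<theta>_def)
  have gA: "bij_betw \<theta> ?A' ?B'"
    using g by (rule bij_betw_cong[THEN iffD1, rotated]) (simp add: \<theta>_def)
  have "?A \<union> ?A' = UNIV" "?B \<union> ?B' = {0..<1} \<times> UNIV"
    by (auto simp: less_le)
  moreover have "bij_betw \<theta> (?A \<union> ?A') (?B \<union> ?B')"
    by (rule bij_betw_combine[OF fA gA]) auto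
  ultimately have "bij_betw \<theta> UNIV ({0..<1} \<times> UNIV)"
    by (simp del: Un_insert_left)
  moreover have "fst v = 0" if "snd (\<theta> v) \<noteq> 0" for v
  proof (rule ccontr)
    assume "fst v \<noteq> 0"
    then have "\<theta> v \<in> ?B'"
      using bij_betwE[OF gA] by blast
    then show False
      using that by auto
  qed
  moreover
  have "(0, 0) \<in> \<theta> ` ?A"
    unfolding bij_betw_imp_surj_on[OF fA] by blast
  then obtain v where "v \<in> ?A" "\<theta> v = (0, 0)"
    by auto
  ultimately show thesis
    using that[of \<theta> v] by simp
qed

text \<open>
  Both \<open>\<langle>a, b\<rangle>\<close> and \<open>\<langle>b, c\<rangle>\<close> act as Baumslag-Solitar groups of affine maps. The space is identified
  with \<open>V \<times> \<int>\<close>, where \<open>b\<close> is the shift of the second factor; the points that \<open>a\<close> translates from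
  \<open>0\<close> and those that \<open>c\<close> moves off the level \<open>0\<close> are kept apart by the choice of \<open>\<theta>\<close>.
\<close>

lemma two_step_higman_action:
  obtains a b c :: "(rat \<times> nat) \<times> int \<Rightarrow> (rat \<times> nat) \<times> int" and N z where
    "bij a" "bij b" "bij c" "b \<circ> a = a \<circ> a \<circ> b" "c \<circ> b = b \<circ> b \<circ> c"
    "\<forall>p. N True p < (N True (a p) :: rat)" "\<forall>p. N False p < N False (c p)"
    "\<forall>p. N True p = 0 \<or> N False p = 0" "N True z = 0" "N False z = 0"
proof -
  obtain \<theta> :: "rat \<times> nat \<Rightarrow> rat \<times> int" and v
    where \<theta>: "bij_betw \<theta> UNIV ({0..<1} \<times> UNIV)" and excl: "\<forall>v. snd (\<theta> v) \<noteq> 0 \<longrightarrow> fst v = 0"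
      and v: "fst v = 0" "snd (\<theta> v) = 0"
    by (rule orbit_identification)
  \<comment> \<open>\<open>b\<close> raises k and so halves the translation: one step of
    \<open>a\<close> before \<open>b\<close> equals two after it.\<close>
  define a :: "(rat \<times> nat) \<times> int \<Rightarrow> (rat \<times> nat) \<times> int"
    where "a = (\<lambda>((u, j), k). ((u + 2 powi (- k), j), k))"
  define b :: "(rat \<times> nat) \<times> int \<Rightarrow> (rat \<times> nat) \<times> int" where "b = (\<lambda>(v, k). (v, k + 1))"
  \<comment> \<open>In the coordinates \<open>g\<close>, \<open>b\<close> is the translation of y by
    1 and \<open>c\<close> doubles y, whence c b = b^2 c. The level m is unaffected by
    \<open>b\<close>; raising it makes \<open>c\<close> move every point, even where y = 0.\<close>
  define g where "g = (\<lambda>(v, k :: int). (fst (\<theta> v) + of_int k, snd (\<theta> v)))"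
  define D :: "rat \<times> int \<Rightarrow> rat \<times> int" where "D = (\<lambda>(y, m). (2 * y, m + 1))"
  define c where "c = inv_into UNIV g \<circ> D \<circ> g"
  define N :: "bool \<Rightarrow> (rat \<times> nat) \<times> int \<Rightarrow> rat"
    where "N i p = (if i then fst (fst p) else of_int (snd (g p)))" for i p
  have "bij a"
    by (rule o_bij[where g = "\<lambda>((u, j), k). ((u - 2 powi (- k), j), k)"]) (auto simp: a_def)
  moreover have "bij b"
    by (rule o_bij[where g = "\<lambda>(v, k). (v, k - 1)"]) (auto simp: b_def)
  moreover have "bij D"
    by (rule o_bij[where g = "\<lambda>(y, m). (y / 2, m - 1)"]) (auto simp: D_def)
  moreover have bij_g: "bij g"
  proof (rule o_bij[where g = "\<lambda>(y, m). (the_inv \<theta> (frac y, m), \<lfloor>y\<rfloor>)"])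
    have inj: "inj \<theta>"
      using \<theta> by (simp add: bij_betw_def)
    show "(\<lambda>(y, m). (the_inv \<theta> (frac y, m), \<lfloor>y\<rfloor>)) \<circ> g = id"
    proof
      fix p :: "(rat \<times> nat) \<times> int"
      obtain w k where p: "p = (w, k)" by (cases p)
      have "\<theta> w \<in> {0..<1} \<times> UNIV"
        using bij_betwE[OF \<theta>] by blast
      then have floor: "\<lfloor>fst (\<theta> w) + of_int k\<rfloor> = k"
        by (intro floor_unique) (auto simp: mem_Times_iff)
      then have "frac (fst (\<theta> w) + of_int k) = fst (\<theta> w)"
        by (simp add: frac_def)
      with floor show "((\<lambda>(y, m). (the_inv \<theta> (frac y, m), \<lfloor>y\<rfloor>)) \<circ> g) p = id p"
        by (simp add: g_def p the_inv_f_f[OF inj])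
    qed
    show "g \<circ> (\<lambda>(y, m). (the_inv \<theta> (frac y, m), \<lfloor>y\<rfloor>)) = id"
    proof
      fix p :: "rat \<times> int"
      obtain y m where p: "p = (y, m)" by (cases p)
      have "(frac y, m) \<in> range \<theta>"
        using \<theta> by (simp add: bij_betw_def frac_ge_0 frac_lt_1)
      then have "\<theta> (the_inv \<theta> (frac y, m)) = (frac y, m)"
        using f_the_inv_into_f[OF inj] by blast
      then show "(g \<circ> (\<lambda>(y, m). (the_inv \<theta> (frac y, m), \<lfloor>y\<rfloor>))) p = id p"
        by (simp add: g_def p frac_def)
    qed
  qed
  ultimately have bij: "bij a" "bij b" "bij c"
    by (simp_all add: c_def bij_comp bij_imp_bij_inv)
  have gc: "g (c p) = D (g p)" for p
    using bij_g by (simp add: c_def surj_f_inv_f bij_is_surj)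
  have gb: "g (b p) = (fst (g p) + 1, snd (g p))" for p
    by (simp add: g_def b_def split: prod.splits)
  have "b \<circ> a = a \<circ> a \<circ> b"
    by (auto simp: a_def b_def fun_eq_iff power_int_diff power_int_minus power_int_add field_simps)
  moreover have "c \<circ> b = b \<circ> b \<circ> c"
  proof
    fix p
    have "g (c (b p)) = g (b (b (c p)))"
      by (simp add: gc gb D_def split: prod.splits)
    then show "(c \<circ> b) p = (b \<circ> b \<circ> c) p"
      using bij_is_inj[OF bij_g] by (simp add: inj_eq)
  qed
  moreover have "N True p < N True (a p)" for p
    by (auto simp: N_def a_def split: prod.splits)
  moreover have "N False p < N False (c p)" for p
    by (auto simp: N_def gc D_def split: prod.splits)
  moreover have "N True p = 0 \<or> N False p = 0" for p
    using excl[rule_format, of "fst p"] by (auto simp: N_def g_def split: prod.splits)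
  moreover have "N True (v, 0) = 0" "N False (v, 0) = 0"
    using v by (simp_all add: N_def g_def)
  ultimately show thesis
    using that[of a b c N "(v, 0)"] bij by blast
qed

section \<open>Generators of Higman's group and their universal property\<close>

lemma exhaust_4: "i = 0 \<or> i = 1 \<or> i = 2 \<or> i = 3" for i :: 4
proof (cases i)
  case (of_int z)
  then have "z = 0 \<or> z = 1 \<or> z = 2 \<or> z = 3" by auto
  then show ?thesis using of_int by auto
qed

definition higman_generator :: "4 \<Rightarrow> 4 word set" where
  "higman_generator i = word_class higman_relations [(i, True)]"

lemma group_higman: "group higman_group"
  unfolding higman_group_def by (rule presented_group_group)

lemma higman_generator_closed: "higman_generator i \<in> carrier higman_group"
  by (simp add: higman_generator_def higman_group_def presented_group_def)

lemma (in group) commutator_self_iff: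
  assumes [simp]: "x \<in> carrier G" "y \<in> carrier G"
  shows "x = y \<otimes> (x \<otimes> (inv y \<otimes> inv x)) \<longleftrightarrow> y \<otimes> x = x \<otimes> x \<otimes> y"
proof -
  have "y \<otimes> (x \<otimes> (inv y \<otimes> inv x)) = (y \<otimes> x) \<otimes> inv (x \<otimes> y)"
    by (simp add: inv_mult_group m_assoc)
  then show ?thesis
    using inv_solve_right[of x "y \<otimes> x" "x \<otimes> y"] by (simp add: m_assoc)
qed

lemma higman_generator_rel:
  "higman_generator (i + 1) \<otimes>\<^bsub>higman_group\<^esub> higman_generator i =
    higman_generator i \<otimes>\<^bsub>higman_group\<^esub> higman_generator i \<otimes>\<^bsub>higman_group\<^esub> higman_generator (i + 1)"
proof -
  let ?H = "higman_group"
  interpret H: group ?H by (rule group_higman)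
  let ?c = "word_class higman_relations"
  have mult: "?c u \<otimes>\<^bsub>?H\<^esub> ?c v = ?c (u @ v)" for u v
    unfolding higman_group_def by (rule presented_group_mult)
  have closed: "?c u \<in> carrier ?H" for u
    by (simp add: higman_group_def presented_group_def)
  have inv: "?c [(j, False)] = inv\<^bsub>?H\<^esub> higman_generator j" for j
  proof (rule H.inv_equality[symmetric])
    have "?c [(j, False), (j, True)] = ?c []"
      using word_eq.cancel[of higman_relations j False] by (simp add: word_class_eq_iff)
    then show "?c [(j, False)] \<otimes>\<^bsub>?H\<^esub> higman_generator j = \<one>\<^bsub>?H\<^esub>"
      by (simp add: higman_generator_def mult) (simp add: higman_group_def presented_group_def)
  qed (simp_all add: closed higman_generator_def)
  have "?c [(i, True)] = ?c (word_commutator [(i + 1, True)] [(i, True)])"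
    unfolding word_class_eq_iff by (rule word_eq.rel) (auto simp: higman_relations_def)
  also have "\<dots> = ?c [(i + 1, True)] \<otimes>\<^bsub>?H\<^esub> (?c [(i, True)] \<otimes>\<^bsub>?H\<^esub>
      (?c [(i + 1, False)] \<otimes>\<^bsub>?H\<^esub> ?c [(i, False)]))"
    by (simp add: mult word_commutator_def word_inv_def)
  finally show ?thesis
    unfolding inv higman_generator_def[symmetric]
    by (rule H.commutator_self_iff[OF higman_generator_closed higman_generator_closed, THEN iffD1])
qed

lemma higman_generator_universal:
  fixes G (structure)
  assumes "group G" and f: "\<And>i. f i \<in> carrier G"
    and rel: "\<And>i. f (i + 1) \<otimes> f i = f i \<otimes> f i \<otimes> f (i + 1)"
  obtains \<psi> where "\<psi> \<in> hom higman_group G" "\<And>i. \<psi> (higman_generator i) = f i"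
proof -
  interpret group G by fact
  have "word_eval G f u = word_eval G f v" if "(u, v) \<in> higman_relations" for u v
  proof -
    obtain i where u: "u = [(i, True)]" and v: "v = word_commutator [(i + 1, True)] [(i, True)]"
      using \<open>(u, v) \<in> higman_relations\<close> by (auto simp: higman_relations_def)
    have "f i = f (i + 1) \<otimes> (f i \<otimes> (inv f (i + 1) \<otimes> inv f i))"
      using commutator_self_iff[OF f f] rel by blast
    then show ?thesis
      using f by (simp add: u v word_commutator_def word_inv_def)
  qed
  then obtain \<psi> where "\<psi> \<in> hom higman_group G" "\<And>u. \<psi> (word_class higman_relations u) = word_eval G f u"
    using presented_group_universal[where R = higman_relations and f = f, OF assms(1) f]
    unfolding higman_group_def by blast
  then show thesis
    using that f by (simp add: higman_generator_def)
qed

theorem higman_generator_nontrivial: "higman_generator 0 \<noteq> \<one>\<^bsub>higman_group\<^esub>"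
proof
  assume trivial: "higman_generator 0 = \<one>\<^bsub>higman_group\<^esub>"
  obtain a b c :: "(rat \<times> nat) \<times> int \<Rightarrow> (rat \<times> nat) \<times> int" and N z where
    bij: "bij a" "bij b" "bij c" and ba: "b \<circ> a = a \<circ> a \<circ> b" and cb: "c \<circ> b = b \<circ> b \<circ> c"
    and N: "\<forall>p. N True p < (N True (a p) :: rat)" "\<forall>p. N False p < N False (c p)"
      "\<forall>p. N True p = 0 \<or> N False p = 0" "N True z = 0" "N False z = 0"
    using two_step_higman_action .
  let ?G = "BijGroup (UNIV :: ((rat \<times> nat) \<times> int) set)"
  interpret G: group ?G by (rule group_BijGroup)
  have car [simp]: "a \<in> carrier ?G" "b \<in> carrier ?G" "c \<in> carrier ?G"
    using bij by (simp_all add: carrier_BijGroup_UNIV)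
  define f where "f i = (if i then a else c)" for i
  have f: "f i \<in> carrier ?G" for i
    by (simp add: f_def)
  have "group_hom ?G ?G (\<lambda>g. g)"
    by (simp add: group_hom_def group_hom_axioms_def hom_def G.is_group)
  then interpret ping_pong ?G UNIV "\<lambda>g. g" f N z
  proof (intro ping_pong.intro group_action.intro ping_pong_axioms.intro)
    show "N i p < N i (f i p)" for i p
      using N(1,2) by (simp add: f_def del: split_paired_All)
    show "N j p = 0" if "i \<noteq> j" "N i p \<noteq> 0" for i j p
      using N(3)[rule_format, of p] that by (cases i; cases j) auto
    show "N i z = 0" for i
      using N by (cases i) auto
  qed (simp_all add: f)
  \<comment> \<open>\<open>\<sigma>\<close> permutes the elements of the full permutation group, not
    the points that it acts on.\<close>
  obtain \<sigma> where \<sigma>: "\<And>g. g \<in> carrier ?G \<Longrightarrow> \<sigma> g \<in> carrier ?G"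
    "\<And>g. g \<in> carrier ?G \<Longrightarrow> \<sigma> (\<sigma> g) = g"
    "\<And>i g. g \<in> carrier ?G \<Longrightarrow> \<sigma> (f i \<otimes>\<^bsub>?G\<^esub> g) = f (\<not> i) \<otimes>\<^bsub>?G\<^esub> \<sigma> g"
    using G.swap_free_generators[of f, OF f word_eval_one_imp] by blast
  let ?B = "BijGroup (carrier ?G)"
  interpret B: group ?B by (rule group_BijGroup)
  define L where "L = (\<lambda>g. \<lambda>x\<in>carrier ?G. g \<otimes>\<^bsub>?G\<^esub> x)"
  interpret L: group_hom ?G ?B L
    by (unfold_locales) (simp add: L_def G.left_mult_hom)
  define s where "s = restrict \<sigma> (carrier ?G)"
  have "bij_betw \<sigma> (carrier ?G) (carrier ?G)"
    by (rule bij_betw_byWitness[where f' = \<sigma>]) (use \<sigma> in auto)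
  then have s: "s \<in> carrier ?B"
    by (simp add: s_def BijGroup_def Bij_def)
  have swap: "s \<otimes>\<^bsub>?B\<^esub> L (f i) = L (f (\<not> i)) \<otimes>\<^bsub>?B\<^esub> s" for i
  proof -
    have mult: "g \<otimes>\<^bsub>?B\<^esub> h = compose (carrier ?G) g h" if "g \<in> carrier ?B" "h \<in> carrier ?B" for g h
      using that by (simp add: BijGroup_def)
    show ?thesis
      unfolding mult[OF s L.hom_closed[OF f]] mult[OF L.hom_closed[OF f] s]
      using \<sigma> f by (auto simp: compose_def s_def L_def intro!: restrict_ext)
  qed
  have "b \<otimes>\<^bsub>?G\<^esub> a = a \<otimes>\<^bsub>?G\<^esub> a \<otimes>\<^bsub>?G\<^esub> b" "c \<otimes>\<^bsub>?G\<^esub> b = b \<otimes>\<^bsub>?G\<^esub> b \<otimes>\<^bsub>?G\<^esub> c"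
    using bij ba cb by (simp_all add: mult_BijGroup_UNIV bij_comp)
  then have rel: "L b \<otimes>\<^bsub>?B\<^esub> L a = L a \<otimes>\<^bsub>?B\<^esub> L a \<otimes>\<^bsub>?B\<^esub> L b"
    "L c \<otimes>\<^bsub>?B\<^esub> L b = L b \<otimes>\<^bsub>?B\<^esub> L b \<otimes>\<^bsub>?B\<^esub> L c"
    using L.hom_mult car G.m_closed by metis+
  define d where "d = s \<otimes>\<^bsub>?B\<^esub> L b \<otimes>\<^bsub>?B\<^esub> inv\<^bsub>?B\<^esub> s"
  have swap_ac: "s \<otimes>\<^bsub>?B\<^esub> L a = L c \<otimes>\<^bsub>?B\<^esub> s" "s \<otimes>\<^bsub>?B\<^esub> L c = L a \<otimes>\<^bsub>?B\<^esub> s"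
    using swap[of True] swap[of False] by (simp_all add: f_def)
  have d: "d \<otimes>\<^bsub>?B\<^esub> L c = L c \<otimes>\<^bsub>?B\<^esub> L c \<otimes>\<^bsub>?B\<^esub> d" "L a \<otimes>\<^bsub>?B\<^esub> d = d \<otimes>\<^bsub>?B\<^esub> d \<otimes>\<^bsub>?B\<^esub> L a"
    using B.higman_extend[OF L.hom_closed L.hom_closed L.hom_closed s rel swap_ac, folded d_def] car
    by blast+
  have d_closed: "d \<in> carrier ?B"
    unfolding d_def using s L.hom_closed[OF car(2)] B.m_closed B.inv_closed by blast
  define F :: "4 \<Rightarrow> _" where "F i = (if i = 0 then L a else if i = 1 then L b else if i = 2 then L c else d)" for i
  have "F i \<in> carrier ?B" for i
    using L.hom_closed car d_closed by (simp add: F_def)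
  moreover have "F (i + 1) \<otimes>\<^bsub>?B\<^esub> F i = F i \<otimes>\<^bsub>?B\<^esub> F i \<otimes>\<^bsub>?B\<^esub> F (i + 1)" for i
    using exhaust_4[of i] rel d by (elim disjE) (simp_all add: F_def)
  ultimately obtain \<psi> where "\<psi> \<in> hom higman_group ?B" "\<psi> (higman_generator 0) = F 0"
    using higman_generator_universal[OF B.is_group, of F] by metis
  \<comment> \<open>Left multiplication is faithful: \<open>L a\<close> sends the identity to
    \<open>a\<close>, while \<open>a\<close> moves \<open>z\<close>.\<close>
  then have "L a = \<one>\<^bsub>?B\<^esub>"
    using hom_one[OF _ group_higman B.is_group] trivial by (metis F_def)
  then have "L a \<one>\<^bsub>?G\<^esub> = \<one>\<^bsub>?G\<^esub>"
    by (simp add: BijGroup_def id_Bij)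
  then have "a = \<one>\<^bsub>?G\<^esub>"
    by (simp add: L_def)
  then have "a z = z"
    by (simp add: BijGroup_def)
  then show False
    using N(1)[rule_format, of z] by simp
qed

text \<open>The right side telescopes. For \<open>x\<close>, \<open>y\<close> images of generators,
  \<open>q\<close> that of the square and \<open>p\<close> the common image of both sides of the
  relation, each factor is a multiplicativity defect or its inverse.\<close>

lemma (in group) commutator_defect_split:
  assumes [simp]: "x \<in> carrier G" "y \<in> carrier G" "p \<in> carrier G" "q \<in> carrier G"
  shows "commutator G y x \<otimes> inv x =
    inv (p \<otimes> inv (y \<otimes> x)) \<otimes> (p \<otimes> inv (q \<otimes> y)) \<otimes> (q \<otimes> inv (x \<otimes> x))"
proof -
  have "inv p \<otimes> (p \<otimes> z) = z" "inv q \<otimes> (q \<otimes> z) = z" if "z \<in> carrier G" for z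
    using that by (simp_all add: m_assoc[symmetric])
  then show ?thesis
    by (simp add: commutator_def inv_mult_group m_assoc)
qed

section \<open>Higman's group is not approximable\<close>

theorem corollary3p3:
  shows "\<not> approximation_property (finite_cc_groups :: ('c monoid \<times> ('c \<Rightarrow> real)) set) higman_group"
proof
  assume "approximation_property (finite_cc_groups :: ('c monoid \<times> ('c \<Rightarrow> real)) set) higman_group"
  then obtain \<delta> where pos: "\<And>g. g \<in> carrier higman_group - {\<one>\<^bsub>higman_group\<^esub>} \<Longrightarrow> \<delta> g > 0"
    and ex: "\<And>F \<epsilon>. finite F \<Longrightarrow> F \<subseteq> carrier higman_group \<Longrightarrow> \<epsilon> > 0 \<Longrightarrow>
        \<exists>(C :: 'c monoid, len) \<in> finite_cc_groups. \<exists>\<phi> \<in> carrier higman_group \<rightarrow> carrier C.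
          \<phi> \<one>\<^bsub>higman_group\<^esub> = \<one>\<^bsub>C\<^esub> \<and>
          (\<forall>g\<in>F. \<forall>h\<in>F. len_dist C len (\<phi> (g \<otimes>\<^bsub>higman_group\<^esub> h)) (\<phi> g \<otimes>\<^bsub>C\<^esub> \<phi> h) < \<epsilon>) \<and>
          (\<forall>g \<in> F - {\<one>\<^bsub>higman_group\<^esub>}. len (\<phi> g) \<ge> \<delta> g)"
    unfolding approximation_property_def by (elim exE conjE) blast
  interpret H: group higman_group by (rule group_higman)
  let ?x = higman_generator
  let ?sq = "\<lambda>i. ?x i \<otimes>\<^bsub>higman_group\<^esub> ?x i"
  have x [simp]: "?x i \<in> carrier higman_group" for i
    by (rule higman_generator_closed)
  \<comment> \<open>The squares are included because the relation is read as a product of the square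
    with a generator.\<close>
  define F where "F = range ?x \<union> range ?sq"
  \<comment> \<open>Three defects give \<eta> = 3 \<epsilon>; 1/48 ensures \<eta> \<le> 1/16, and
    1/9 keeps 2 \<eta> below \<delta>.\<close>
  define \<epsilon> where "\<epsilon> = min (1 / 48) (\<delta> (?x 0) / 9)"
  have \<delta>0: "\<delta> (?x 0) > 0"
    using pos higman_generator_nontrivial by simp
  have \<epsilon>: "\<epsilon> > 0" "3 * \<epsilon> \<le> 1 / 16" "6 * \<epsilon> < \<delta> (?x 0)"
    using \<delta>0 by (auto simp: \<epsilon>_def min_def)
  have F: "finite F" "F \<subseteq> carrier higman_group" "?x i \<in> F" "?sq i \<in> F" for i
    by (auto simp: F_def)
  obtain C :: "'c monoid" and len \<phi> where C: "(C, len) \<in> finite_cc_groups"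
    and \<phi>: "\<phi> \<in> carrier higman_group \<rightarrow> carrier C"
    and d: "\<And>g h. g \<in> F \<Longrightarrow> h \<in> F \<Longrightarrow>
      len_dist C len (\<phi> (g \<otimes>\<^bsub>higman_group\<^esub> h)) (\<phi> g \<otimes>\<^bsub>C\<^esub> \<phi> h) < \<epsilon>"
    and l: "\<And>g. g \<in> F - {\<one>\<^bsub>higman_group\<^esub>} \<Longrightarrow> len (\<phi> g) \<ge> \<delta> g"
    using ex[OF F(1,2) \<epsilon>(1)]
    by (elim bexE case_prodE conjE, hypsubst) (rule that, assumption+, blast, blast)
  interpret C: finite_cc_group C len
    using C by (simp add: finite_cc_groups_def finite_cc_group_def finite_cc_group_axioms_def)
  define b where "b i = \<phi> (?x i)" for i
  have \<phi>_closed: "\<phi> g \<in> carrier C" if "g \<in> carrier higman_group" for g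
    using \<phi> that by blast
  have b: "b i \<in> carrier C" for i
    by (simp add: b_def \<phi>_closed)
  have "len (commutator C (b (i + 1)) (b i) \<otimes>\<^bsub>C\<^esub> inv\<^bsub>C\<^esub> b i) \<le> 3 * \<epsilon>" for i
  proof -
    define p where "p = \<phi> (?x (i + 1) \<otimes>\<^bsub>higman_group\<^esub> ?x i)"
    define q where "q = \<phi> (?sq i)"
    have car: "p \<in> carrier C" "q \<in> carrier C" "b i \<in> carrier C" "b (i + 1) \<in> carrier C"
      by (simp_all add: p_def q_def b \<phi>_closed)
    \<comment> \<open>The relation is exact in Higman's group, so both of its sides have the image
      \<open>p\<close>.\<close>
    have p_eq: "p = \<phi> (?sq i \<otimes>\<^bsub>higman_group\<^esub> ?x (i + 1))"
      by (simp only: p_def higman_generator_rel)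
    let ?u = "p \<otimes>\<^bsub>C\<^esub> inv\<^bsub>C\<^esub> (b (i + 1) \<otimes>\<^bsub>C\<^esub> b i)"
    let ?v = "p \<otimes>\<^bsub>C\<^esub> inv\<^bsub>C\<^esub> (q \<otimes>\<^bsub>C\<^esub> b (i + 1))"
    let ?w = "q \<otimes>\<^bsub>C\<^esub> inv\<^bsub>C\<^esub> (b i \<otimes>\<^bsub>C\<^esub> b i)"
    have len: "len ?u < \<epsilon>" "len ?v < \<epsilon>" "len ?w < \<epsilon>"
      using d[OF F(3,3), of "i + 1" i] d[OF F(4,3), of i "i + 1"] d[OF F(3,3), of i i]
      unfolding len_dist_def p_eq[symmetric] p_def[symmetric] q_def[symmetric] b_def[symmetric] by simp_all
    have closed: "?u \<in> carrier C" "?v \<in> carrier C" "?w \<in> carrier C"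
      using car by simp_all
    have split: "commutator C (b (i + 1)) (b i) \<otimes>\<^bsub>C\<^esub> inv\<^bsub>C\<^esub> b i = inv\<^bsub>C\<^esub> ?u \<otimes>\<^bsub>C\<^esub> ?v \<otimes>\<^bsub>C\<^esub> ?w"
      using car by (intro C.commutator_defect_split)
    have "len (inv\<^bsub>C\<^esub> ?u \<otimes>\<^bsub>C\<^esub> ?v \<otimes>\<^bsub>C\<^esub> ?w) \<le> len (inv\<^bsub>C\<^esub> ?u \<otimes>\<^bsub>C\<^esub> ?v) + len ?w"
      by (intro C.len_mult_le C.m_closed C.inv_closed closed)
    moreover have "len (inv\<^bsub>C\<^esub> ?u \<otimes>\<^bsub>C\<^esub> ?v) \<le> len (inv\<^bsub>C\<^esub> ?u) + len ?v"
      by (intro C.len_mult_le C.inv_closed closed)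
    moreover have "len (inv\<^bsub>C\<^esub> ?u) = len ?u"
      by (rule C.len_inv[OF closed(1)])
    ultimately show ?thesis
      unfolding split using len by linarith
  qed
  then have "len (b 0) \<le> 2 * (3 * \<epsilon>)"
    using C.almost_higman_relations_small[of b "3 * \<epsilon>" "\<lambda>i. i + 1" 0] b \<epsilon> by simp
  moreover have "\<delta> (?x 0) \<le> len (b 0)"
    unfolding b_def using l F(3) higman_generator_nontrivial by blast
  ultimately show False
    using \<epsilon>(3) by simp
qed

end
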